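(* Let $-1<\alpha<\infty$, let $f\in\mathbb{A}^2_\alpha(\mathbf{D})$, and let $(a_1,\dots,a_n,\dots)$ be a sequence in $\mathbf{D}$ obtained by consecutive maximal selections for $f$, i.e. for every $n\ge1$, $$|\langle f,B_n^{a_n}\rangle|^2=\sup\{|\langle f,B_n^b\rangle|^2:\ b\in\mathbf{D}\},$$ where for $b\in\mathbf{D}$, $(B_1,\dots,B_{n-1},B_n^b)$ is the Gram–Schmidt orthonormalization in $\mathbb{A}^2_\alpha(\mathbf{D})$ of the generalized reproducing kernels $(\tilde k^\alpha_{a_1},\dots,\tilde k^\alpha_{a_{n-1}},\tilde k^\alpha_b)$ associated with the tuple $(a_1,\dots,a_{n-1},b)$, and $B_n=B_n^{a_n}$. Then $$f=\sum_{k=1}^\infty\langle f,B_k\rangle B_k,$$ with convergence in the norm of $\mathbb{A}^2_\alpha(\mathbf{D})$.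
   Context: $\mathbf{D}$ is the open unit disc. $\mathbb{A}^2_\alpha(\mathbf{D})$ is the Hilbert space of holomorphic functions $f$ on $\mathbf{D}$ with $\|f\|^2=\int_{\mathbf{D}}|f|^2\,dA_\alpha<\infty$, where $dA_\alpha(z)=(1+\alpha)(1-|z|^2)^\alpha dA(z)$ and $dA=dx\,dy/\pi$; the inner product is $\langle f,g\rangle=\int_{\mathbf{D}}f\overline g\,dA_\alpha$. Its reproducing kernel is $k^\alpha_w(z)=\frac1{(1-\overline wz)^{2+\alpha}}$ (principal branch). For a tuple $(a_1,\dots,a_n)$ of points of $\mathbf{D}$ (repetitions allowed), $l(a_j)$ is the number of times the value $a_j$ occurs in $(a_1,\dots,a_j)$, and the generalized reproducing kernels associated with the tuple are $\tilde k^\alpha_{a_j}(z)=\left(\frac{d}{d\overline w}\right)^{l(a_j)-1}k^\alpha_w(z)\big|_{w=a_j}$. *)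

theory Defs
  imports "HOL-Analysis.Analysis"
begin

text \<open>Functions on the open unit disc are represented by total functions on the complex plane;
  their values outside the disc play no role.\<close>

abbreviation unit_disc :: "complex set" where
  "unit_disc \<equiv> ball 0 1"

text \<open>Normalized weighted area measure on the disc; the factor \<open>1 / pi\<close> comes from
  \<open>dA = dx dy / pi\<close>.\<close>

definition weighted_area :: "real \<Rightarrow> complex measure" where
  "weighted_area \<alpha> =
     density (restrict_space lborel unit_disc)
       (\<lambda>z. ennreal ((1 + \<alpha>) * (1 - (cmod z)\<^sup>2) powr \<alpha> / pi))"

definition bergman_space :: "real \<Rightarrow> (complex \<Rightarrow> complex) set" where
  "bergman_space \<alpha> =
     {f. f holomorphic_on unit_disc \<and> integrable (weighted_area \<alpha>) (\<lambda>z. (cmod (f z))\<^sup>2)}"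

definition bergman_inner :: "real \<Rightarrow> (complex \<Rightarrow> complex) \<Rightarrow> (complex \<Rightarrow> complex) \<Rightarrow> complex" where
  "bergman_inner \<alpha> f g = (LINT z|weighted_area \<alpha>. f z * cnj (g z))"

definition bergman_norm :: "real \<Rightarrow> (complex \<Rightarrow> complex) \<Rightarrow> real" where
  "bergman_norm \<alpha> f = sqrt (LINT z|weighted_area \<alpha>. (cmod (f z))\<^sup>2)"

definition bergman_kernel :: "real \<Rightarrow> complex \<Rightarrow> complex \<Rightarrow> complex" where
  "bergman_kernel \<alpha> w z = 1 / (1 - cnj w * z) powr complex_of_real (2 + \<alpha>)"

text \<open>The Wirtinger derivative with respect to the conjugate variable,
  \<open>(d/dx + i d/dy) / 2\<close>; the derivative below is the real one.\<close>

definition wirtinger_cnj :: "(complex \<Rightarrow> complex) \<Rightarrow> complex \<Rightarrow> complex" where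
  "wirtinger_cnj g w =
     (frechet_derivative g (at w) 1 + \<i> * frechet_derivative g (at w) \<i>) / 2"

text \<open>Tuples and sequences are indexed from 0, so \<open>a j\<close> is the \<open>(j + 1)\<close>-st point. A tuple
  \<open>(a 0, \<dots>, a n)\<close> is given by any function extending it: the constructions at index \<open>n\<close>
  depend only on the values at indices up to \<open>n\<close>.\<close>

definition occurrence :: "(nat \<Rightarrow> complex) \<Rightarrow> nat \<Rightarrow> nat" where
  "occurrence a j = card {i. i \<le> j \<and> a i = a j}"

definition gen_kernel :: "real \<Rightarrow> (nat \<Rightarrow> complex) \<Rightarrow> nat \<Rightarrow> complex \<Rightarrow> complex" where
  "gen_kernel \<alpha> a j z =
     (wirtinger_cnj ^^ (occurrence a j - 1)) (\<lambda>w. bergman_kernel \<alpha> w z) (a j)"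

fun gram_schmidt :: "real \<Rightarrow> (nat \<Rightarrow> complex \<Rightarrow> complex) \<Rightarrow> nat \<Rightarrow> complex \<Rightarrow> complex" where
  "gram_schmidt \<alpha> v n =
     (let u = (\<lambda>z. v n z -
            (\<Sum>k<n. bergman_inner \<alpha> (v n) (gram_schmidt \<alpha> v k) * gram_schmidt \<alpha> v k z))
      in (\<lambda>z. u z / complex_of_real (bergman_norm \<alpha> u)))"

declare gram_schmidt.simps [simp del]

definition kernel_onb :: "real \<Rightarrow> (nat \<Rightarrow> complex) \<Rightarrow> nat \<Rightarrow> complex \<Rightarrow> complex" where
  "kernel_onb \<alpha> a n = gram_schmidt \<alpha> (gen_kernel \<alpha> a) n"

text \<open>The tuple \<open>(a 0, \<dots>, a (n - 1), b)\<close> is represented by \<open>a(n := b)\<close>.\<close>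

definition consecutive_maximal_selections ::
  "real \<Rightarrow> (complex \<Rightarrow> complex) \<Rightarrow> (nat \<Rightarrow> complex) \<Rightarrow> bool" where
  "consecutive_maximal_selections \<alpha> f a \<longleftrightarrow>
     (\<forall>n. a n \<in> unit_disc) \<and>
     (\<forall>n. (cmod (bergman_inner \<alpha> f (kernel_onb \<alpha> a n)))\<^sup>2 =
          (SUP b\<in>unit_disc. (cmod (bergman_inner \<alpha> f (kernel_onb \<alpha> (a(n := b)) n)))\<^sup>2))"

end

theory Submission
  imports Defs "HOL-Complex_Analysis.Complex_Analysis"
begin

text \<open>Let \<open>f\<^sub>n\<close> be the residual of \<open>f\<close> after \<open>n\<close> steps. By Bessel's inequality the coefficients
  \<open>\<langle>f, B\<^sub>n\<rangle>\<close> are square summable, so \<open>(f\<^sub>n)\<close> is a Cauchy sequence and the coefficients tend to 0. For a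
  point \<open>b\<close> outside the sequence \<open>a\<close>, the reproducing property bounds \<open>|f\<^sub>n(b)|\<close> by a constant times
  \<open>|\<langle>f, B\<^sub>n\<^sup>b\<rangle>|\<close>, hence by maximality by the same constant times \<open>|\<langle>f, B\<^sub>n\<rangle>|\<close>. So \<open>f\<^sub>n \<rightarrow> 0\<close> off a countable set, and
  Fatou's lemma applied to \<open>|f\<^sub>n - f\<^sub>m|\<^sup>2\<close> as \<open>m \<rightarrow> \<infinity>\<close> turns the Cauchy property into
  \<open>\<parallel>f\<^sub>n\<parallel> \<rightarrow> 0\<close>.

  The reproducing property, up to the factor \<open>A\<^sub>\<alpha>(D)\<close>, which need not be evaluated, follows from the
  mean value property at 0 by the disc automorphism exchanging 0 and \<open>b\<close>.\<close>

section \<open>Holomorphic change of variables in the plane\<close>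

text \<open>The area formula with a Jacobian determinant speaks about \<open>real^2\<close>. This
  map and its inverse below carry it over to \<open>complex\<close>.\<close>

definition complex_of_vec :: "real^2 \<Rightarrow> complex" where
  "complex_of_vec x = Complex (x $ 1) (x $ 2)"

definition vec_of_complex :: "complex \<Rightarrow> real^2" where
  "vec_of_complex z = vector [Re z, Im z]"

lemma vec_of_complex_inverse [simp]: "complex_of_vec (vec_of_complex z) = z"
  by (simp add: complex_of_vec_def vec_of_complex_def)

lemma complex_of_vec_inverse [simp]: "vec_of_complex (complex_of_vec x) = x"
  by (simp add: complex_of_vec_def vec_of_complex_def vec_eq_iff forall_2)

lemma bounded_linear_complex_of_vec: "bounded_linear complex_of_vec"
  by (rule linear_conv_bounded_linear[THEN iffD1])
     (auto intro!: linearI simp: complex_of_vec_def complex_eq_iff)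

lemma bounded_linear_vec_of_complex: "bounded_linear vec_of_complex"
  by (rule linear_conv_bounded_linear[THEN iffD1])
     (auto intro!: linearI simp: vec_of_complex_def vec_eq_iff forall_2)

lemma measurable_complex_of_vec [measurable]: "complex_of_vec \<in> borel \<rightarrow>\<^sub>M borel"
  by (intro borel_measurable_continuous_onI linear_continuous_on bounded_linear_complex_of_vec)

text \<open>Lebesgue measure is determined by its values on boxes, and the preimage of a box is a
  box with the same side lengths.\<close>

lemma lborel_complex_eq_distr: "lborel = distr lborel borel complex_of_vec"
proof (rule lborel_eqI)
  fix l u :: complex
  assume le: "\<And>b. b \<in> Basis \<Longrightarrow> l \<bullet> b \<le> u \<bullet> b"
  have "complex_of_vec -` box l u = box (vec_of_complex l) (vec_of_complex u)"
    by (auto simp: box_def Basis_complex_def complex_of_vec_def vec_of_complex_def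
          Basis_vec_def inner_axis forall_2 exhaust_2)
  moreover have "vec_of_complex l \<bullet> b \<le> vec_of_complex u \<bullet> b" if "b \<in> Basis" for b
    using le[of 1] le[of \<i>] that
    by (auto simp: Basis_complex_def vec_of_complex_def Basis_vec_def inner_axis UNIV_2)
  moreover have "(\<Prod>b\<in>Basis. (vec_of_complex u - vec_of_complex l) \<bullet> b) = (\<Prod>b\<in>Basis. (u - l) \<bullet> b)"
    by (simp add: Basis_complex_def vec_of_complex_def Basis_vec_def inner_axis UNIV_2 axis_eq_axis)
  ultimately show "emeasure (distr lborel borel complex_of_vec) (box l u) = (\<Prod>b\<in>Basis. (u - l) \<bullet> b)"
    by (simp add: emeasure_distr)
qed auto

text \<open>The area formula for injective maps. By the Cauchy-Riemann equations the real Jacobian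
  determinant of a holomorphic map is the squared modulus of its derivative.\<close>

lemma emeasure_lborel_holomorphic_image:
  assumes S: "S \<in> sets borel"
    and der: "\<And>z. z \<in> S \<Longrightarrow> (\<phi> has_field_derivative \<phi>' z) (at z)"
    and cont: "continuous_on S \<phi>'"
    and inj: "inj_on \<phi> S"
    and image: "\<phi> ` S \<in> sets borel" "emeasure lborel (\<phi> ` S) < \<infinity>"
  shows "(\<integral>\<^sup>+z. ennreal ((cmod (\<phi>' z))\<^sup>2) * indicator S z \<partial>lborel) = emeasure lborel (\<phi> ` S)"
proof -
  define g where "g = vec_of_complex \<circ> \<phi> \<circ> complex_of_vec"
  define S' where "S' = complex_of_vec -` S"
  define g' where "g' x = (\<lambda>h. vec_of_complex (\<phi>' (complex_of_vec x) * complex_of_vec h))" for x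
  define m where "m = measure lborel (\<phi> ` S)"
  have S': "S' \<in> sets borel"
    unfolding S'_def using measurable_sets[OF measurable_complex_of_vec S] by simp
  have der': "(g has_derivative g' x) (at x within S')" if "x \<in> S'" for x
  proof -
    have "(\<phi> has_derivative (\<lambda>h. \<phi>' (complex_of_vec x) * h)) (at (complex_of_vec x))"
      using der that by (auto simp: S'_def has_field_derivative_def)
    then have "((\<lambda>x. vec_of_complex (\<phi> (complex_of_vec x))) has_derivative g' x) (at x)"
      unfolding g'_def
      by (intro bounded_linear.has_derivative[OF bounded_linear_vec_of_complex]
           has_derivative_compose[OF bounded_linear.has_derivative[OF bounded_linear_complex_of_vec has_derivative_ident]])
         auto
    then show ?thesis by (auto simp: g_def o_def intro: has_derivative_at_withinI)
  qed
  \<comment> \<open>Multiplication by p + iq has the real matrix with rows (p, -q) and (q, p), whose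
    determinant is p^2 + q^2.\<close>
  have det: "\<bar>det (matrix (g' x))\<bar> = (cmod (\<phi>' (complex_of_vec x)))\<^sup>2" for x
    by (simp add: det_2 matrix_def g'_def vec_of_complex_def complex_of_vec_def axis_def cmod_def power2_eq_square)
  have inj': "inj_on g S'"
    using inj by (auto simp: inj_on_def g_def S'_def) (metis complex_of_vec_inverse vec_of_complex_inverse)
  have im: "g ` S' = complex_of_vec -` (\<phi> ` S)"
  proof (intro equalityI subsetI)
    fix x assume "x \<in> complex_of_vec -` (\<phi> ` S)"
    then obtain z where "z \<in> S" "complex_of_vec x = \<phi> z" by auto
    then have "vec_of_complex z \<in> S'" "x = g (vec_of_complex z)"
      using complex_of_vec_inverse[of x] by (auto simp: g_def S'_def)
    then show "x \<in> g ` S'" by blast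
  qed (auto simp: g_def S'_def)
  have im_sets: "g ` S' \<in> sets borel"
    unfolding im using measurable_sets[OF measurable_complex_of_vec image(1)] by simp
  have em: "emeasure lborel (g ` S') = emeasure lborel (\<phi> ` S)"
    using arg_cong[OF lborel_complex_eq_distr, of "\<lambda>M. emeasure M (\<phi> ` S)"]
    by (simp add: im emeasure_distr image)
  have "g ` S' \<in> lmeasurable"
    using im_sets em image(2) by (auto simp: fmeasurable_def)
  moreover have "measure lebesgue (g ` S') = m"
    using em im_sets by (simp add: measure_def m_def)
  ultimately have "((\<lambda>x. \<bar>det (matrix (g' x))\<bar>) has_integral m) S'"
    using has_measure_differentiable_image[of S' g g' m] S' der' inj' by auto
  then have "((\<lambda>x. (cmod (\<phi>' (complex_of_vec x)))\<^sup>2) has_integral m) S'"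
    by (simp add: det)
  from nn_integral_has_integral_lebesgue'[OF _ this]
  have *: "(\<integral>\<^sup>+x. ennreal ((cmod (\<phi>' (complex_of_vec x)))\<^sup>2) * indicator S' x \<partial>lborel) = ennreal m"
    by simp
  \<comment> \<open>Continuity of \<open>\<phi>'\<close> is known on \<open>S\<close> only; cutting
    off by the indicator gives a Borel function on the whole plane, as the transfer of the integral
    requires.\<close>
  have "(\<lambda>z. indicator S z *\<^sub>R (cmod (\<phi>' z))\<^sup>2) \<in> borel_measurable borel"
    using S by (intro borel_measurable_continuous_on_indicator continuous_intros cont)
  then have "(\<lambda>z. ennreal (indicator S z *\<^sub>R (cmod (\<phi>' z))\<^sup>2)) \<in> borel_measurable borel"
    by measurable
  also have "(\<lambda>z. ennreal (indicator S z *\<^sub>R (cmod (\<phi>' z))\<^sup>2)) = (\<lambda>z. ennreal ((cmod (\<phi>' z))\<^sup>2) * indicator S z)"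
    by (auto simp: indicator_def)
  finally have 1: "(\<lambda>z. ennreal ((cmod (\<phi>' z))\<^sup>2) * indicator S z) \<in> borel_measurable borel" .
  show ?thesis
    apply (subst lborel_complex_eq_distr)
    apply (subst nn_integral_distr)
    using * 1 image by (auto simp: S'_def m_def emeasure_eq_ennreal_measure indicator_def vimage_def)
qed

section \<open>The weighted area measure\<close>

definition weight :: "real \<Rightarrow> complex \<Rightarrow> real" where
  "weight \<alpha> z = (1 + \<alpha>) * (1 - (cmod z)\<^sup>2) powr \<alpha> / pi"

abbreviation disc_lborel :: "complex measure" where
  "disc_lborel \<equiv> restrict_space lborel unit_disc"

lemma measurable_weight [measurable]: "weight \<alpha> \<in> borel_measurable borel"
  unfolding weight_def by measurable

lemma weighted_area_eq: "weighted_area \<alpha> = density disc_lborel (\<lambda>z. ennreal (weight \<alpha> z))"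
  unfolding weighted_area_def weight_def ..

lemma sets_weighted_area [measurable_cong]: "sets (weighted_area \<alpha>) = sets (restrict_space borel unit_disc)"
  by (simp add: weighted_area_eq sets_restrict_space)

lemma space_weighted_area [simp]: "space (weighted_area \<alpha>) = unit_disc"
  by (simp add: weighted_area_eq space_restrict_space)

lemma continuous_on_disc_measurable:
  assumes "continuous_on unit_disc F"
  shows "F \<in> borel_measurable (weighted_area \<alpha>)" "F \<in> borel_measurable disc_lborel"
  using borel_measurable_continuous_on_restrict[OF assms]
  by (auto simp: measurable_cong_sets[OF sets_weighted_area refl]
        measurable_cong_sets[OF sets_restrict_space_cong[OF sets_lborel] refl])

lemma weight_nonneg: "-1 < \<alpha> \<Longrightarrow> weight \<alpha> z \<ge> 0"
  unfolding weight_def by simp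

text \<open>Two measures are compared on a set \<open>A\<close> by applying the area formula to its
  preimage. As an identity of image measures, the change of variables serves integrability and
  integrals alike.\<close>

lemma distr_disc_automorphism:
  assumes der: "\<And>z. z \<in> unit_disc \<Longrightarrow> (\<phi> has_field_derivative \<phi>' z) (at z)"
    and cont: "continuous_on unit_disc \<phi>'"
    and bij: "bij_betw \<phi> unit_disc unit_disc"
  shows "distr (density disc_lborel (\<lambda>z. ennreal ((cmod (\<phi>' z))\<^sup>2))) disc_lborel \<phi> = disc_lborel"
    and "\<phi> \<in> disc_lborel \<rightarrow>\<^sub>M disc_lborel"
proof -
  have cont_\<phi>: "continuous_on unit_disc \<phi>"
    using der by (meson DERIV_continuous_on has_field_derivative_at_within)
  have maps: "\<phi> z \<in> unit_disc" if "z \<in> unit_disc" for z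
    using bij that by (auto simp: bij_betw_def)
  show meas: "\<phi> \<in> disc_lborel \<rightarrow>\<^sub>M disc_lborel"
    using continuous_on_disc_measurable(2)[OF cont_\<phi>] maps
    by (auto intro!: measurable_restrict_space2 simp: space_restrict_space)
  have [measurable]: "\<phi>' \<in> borel_measurable disc_lborel"
    by (rule continuous_on_disc_measurable(2)[OF cont])
  show "distr (density disc_lborel (\<lambda>z. ennreal ((cmod (\<phi>' z))\<^sup>2))) disc_lborel \<phi> = disc_lborel"
  proof (rule measure_eqI)
    fix A assume "A \<in> sets (distr (density disc_lborel (\<lambda>z. ennreal ((cmod (\<phi>' z))\<^sup>2))) disc_lborel \<phi>)"
    then have A: "A \<in> sets disc_lborel" by simp
    then have A': "A \<subseteq> unit_disc" "A \<in> sets borel"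
      by (auto simp: sets_restrict_space_iff)
    define S where "S = \<phi> -` A \<inter> unit_disc"
    have S: "S \<in> sets disc_lborel"
      using measurable_sets[OF meas A] by (simp add: S_def space_restrict_space)
    then have S': "S \<subseteq> unit_disc" "S \<in> sets borel"
      by (auto simp: sets_restrict_space_iff)
    have "A \<subseteq> \<phi> ` unit_disc"
      using bij A' by (simp add: bij_betw_def)
    then have im: "\<phi> ` S = A"
      unfolding S_def by blast
    have "emeasure lborel A \<le> emeasure lborel unit_disc"
      using A' by (intro emeasure_mono) auto
    then have fin: "emeasure lborel A < \<infinity>"
      using emeasure_lborel_ball_finite[of 0 1] by (meson order_le_less_trans)
    have "emeasure (distr (density disc_lborel (\<lambda>z. ennreal ((cmod (\<phi>' z))\<^sup>2))) disc_lborel \<phi>) A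
        = emeasure (density disc_lborel (\<lambda>z. ennreal ((cmod (\<phi>' z))\<^sup>2))) S"
      using meas A by (subst emeasure_distr) (auto simp: S_def space_restrict_space)
    also have "\<dots> = (\<integral>\<^sup>+z. ennreal ((cmod (\<phi>' z))\<^sup>2) * indicator S z \<partial>disc_lborel)"
      using S by (subst emeasure_density) auto
    also have "\<dots> = (\<integral>\<^sup>+z. ennreal ((cmod (\<phi>' z))\<^sup>2) * indicator S z * indicator unit_disc z \<partial>lborel)"
      by (subst nn_integral_restrict_space) auto
    also have "\<dots> = (\<integral>\<^sup>+z. ennreal ((cmod (\<phi>' z))\<^sup>2) * indicator S z \<partial>lborel)"
      using S' by (intro nn_integral_cong) (auto simp: indicator_def)
    also have "\<dots> = emeasure lborel (\<phi> ` S)"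
      using S' der bij cont fin A' unfolding bij_betw_def
      by (intro emeasure_lborel_holomorphic_image)
         (auto simp: im intro: continuous_on_subset inj_on_subset)
    also have "\<dots> = emeasure disc_lborel A"
      using A' by (simp add: im emeasure_restrict_space)
    finally show "emeasure (distr (density disc_lborel (\<lambda>z. ennreal ((cmod (\<phi>' z))\<^sup>2))) disc_lborel \<phi>) A
        = emeasure disc_lborel A" .
  qed auto
qed

text \<open>\<open>J\<close> collects the Jacobian and the change of the weight, so that
  substituting \<open>\<phi>\<close> multiplies the weighted area by \<open>J\<close>. It is 1 for
  rotations, and a power of (1 - |b|^2) / |1 - cnj b z|^2 for the disc involution.\<close>

lemma weighted_area_automorphism:
  fixes F :: "complex \<Rightarrow> 'b :: {banach, second_countable_topology}"
  assumes \<alpha>: "-1 < \<alpha>"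
    and der: "\<And>z. z \<in> unit_disc \<Longrightarrow> (\<phi> has_field_derivative \<phi>' z) (at z)"
    and cont: "continuous_on unit_disc \<phi>'"
    and bij: "bij_betw \<phi> unit_disc unit_disc"
    and J: "\<And>z. z \<in> unit_disc \<Longrightarrow> (cmod (\<phi>' z))\<^sup>2 * weight \<alpha> (\<phi> z) = weight \<alpha> z * J z"
    and contJ: "continuous_on unit_disc J"
    and contF: "continuous_on unit_disc F"
  shows "integrable (weighted_area \<alpha>) F \<longleftrightarrow> integrable (weighted_area \<alpha>) (\<lambda>z. J z *\<^sub>R F (\<phi> z))"
    and "integral\<^sup>L (weighted_area \<alpha>) F = integral\<^sup>L (weighted_area \<alpha>) (\<lambda>z. J z *\<^sub>R F (\<phi> z))"
proof -
  have d: "distr (density disc_lborel (\<lambda>z. ennreal ((cmod (\<phi>' z))\<^sup>2))) disc_lborel \<phi> = disc_lborel"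
    "\<phi> \<in> disc_lborel \<rightarrow>\<^sub>M disc_lborel"
    using distr_disc_automorphism[OF der cont bij] by auto
  note d(2)[measurable]
  note weight_nonneg[OF \<alpha>, simp]
  have [measurable]: "F \<in> borel_measurable disc_lborel" "\<phi>' \<in> borel_measurable disc_lborel"
     "J \<in> borel_measurable disc_lborel"
    using contF cont contJ by (auto intro: continuous_on_disc_measurable(2))
  have [measurable]: "weight \<alpha> \<in> borel_measurable disc_lborel"
    by (intro measurable_restrict_space1) simp
  have D: "\<phi> \<in> density disc_lborel (\<lambda>z. ennreal ((cmod (\<phi>' z))\<^sup>2)) \<rightarrow>\<^sub>M disc_lborel"
    using d(2) by simp
  have G: "(\<lambda>z. weight \<alpha> z *\<^sub>R F z) \<in> borel_measurable disc_lborel"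
    by measurable
  have "integrable (weighted_area \<alpha>) F \<longleftrightarrow> integrable disc_lborel (\<lambda>z. weight \<alpha> z *\<^sub>R F z)"
    unfolding weighted_area_eq by (subst integrable_density) auto
  also have "\<dots> \<longleftrightarrow> integrable (density disc_lborel (\<lambda>z. ennreal ((cmod (\<phi>' z))\<^sup>2))) (\<lambda>z. weight \<alpha> (\<phi> z) *\<^sub>R F (\<phi> z))"
    using integrable_distr_eq[OF D G] unfolding d(1) .
  also have "\<dots> \<longleftrightarrow> integrable disc_lborel (\<lambda>z. (cmod (\<phi>' z))\<^sup>2 *\<^sub>R weight \<alpha> (\<phi> z) *\<^sub>R F (\<phi> z))"
    by (subst integrable_density) auto
  also have "\<dots> \<longleftrightarrow> integrable disc_lborel (\<lambda>z. weight \<alpha> z *\<^sub>R J z *\<^sub>R F (\<phi> z))"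
    using J by (intro Bochner_Integration.integrable_cong refl) (auto simp: space_restrict_space)
  also have "\<dots> \<longleftrightarrow> integrable (weighted_area \<alpha>) (\<lambda>z. J z *\<^sub>R F (\<phi> z))"
    unfolding weighted_area_eq by (subst integrable_density) auto
  finally show "integrable (weighted_area \<alpha>) F \<longleftrightarrow> integrable (weighted_area \<alpha>) (\<lambda>z. J z *\<^sub>R F (\<phi> z))" .
  have "integral\<^sup>L (weighted_area \<alpha>) F = integral\<^sup>L disc_lborel (\<lambda>z. weight \<alpha> z *\<^sub>R F z)"
    unfolding weighted_area_eq by (subst integral_density) auto
  also have "\<dots> = integral\<^sup>L (density disc_lborel (\<lambda>z. ennreal ((cmod (\<phi>' z))\<^sup>2))) (\<lambda>z. weight \<alpha> (\<phi> z) *\<^sub>R F (\<phi> z))"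
    using integral_distr[OF D G] unfolding d(1) .
  also have "\<dots> = integral\<^sup>L disc_lborel (\<lambda>z. (cmod (\<phi>' z))\<^sup>2 *\<^sub>R weight \<alpha> (\<phi> z) *\<^sub>R F (\<phi> z))"
    by (subst integral_density) auto
  also have "\<dots> = integral\<^sup>L disc_lborel (\<lambda>z. weight \<alpha> z *\<^sub>R J z *\<^sub>R F (\<phi> z))"
    using J by (intro Bochner_Integration.integral_cong refl) (auto simp: space_restrict_space)
  also have "\<dots> = integral\<^sup>L (weighted_area \<alpha>) (\<lambda>z. J z *\<^sub>R F (\<phi> z))"
    unfolding weighted_area_eq by (subst integral_density) auto
  finally show "integral\<^sup>L (weighted_area \<alpha>) F = integral\<^sup>L (weighted_area \<alpha>) (\<lambda>z. J z *\<^sub>R F (\<phi> z))" .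
qed

section \<open>Finiteness and positivity of the weighted area\<close>

lemma emeasure_annulus_le:
  assumes "0 \<le> r" "r \<le> s" "s \<le> 1"
  shows "emeasure lborel (ball (0::complex) s - ball 0 r) \<le> ennreal (2 * pi * (s - r))"
proof -
  have "emeasure lborel (ball (0::complex) s - ball 0 r) = emeasure lborel (ball (0::complex) s) - emeasure lborel (ball (0::complex) r)"
    using assms emeasure_lborel_ball_finite[of "0::complex" r]
    by (intro emeasure_Diff) (auto simp: subset_ball)
  also have "\<dots> = ennreal (pi * s\<^sup>2 - pi * r\<^sup>2)"
    using assms by (simp add: emeasure_ball unit_ball_vol_2 ennreal_minus)
  also have "\<dots> \<le> ennreal (2 * pi * (s - r))"
  proof (rule ennreal_leI)
    have "pi * s\<^sup>2 - pi * r\<^sup>2 = (s + r) * (pi * (s - r))"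
      by (simp add: power2_eq_square algebra_simps)
    also have "\<dots> \<le> 2 * (pi * (s - r))"
      using assms by (intro mult_right_mono) auto
    finally show "pi * s\<^sup>2 - pi * r\<^sup>2 \<le> 2 * pi * (s - r)" by simp
  qed
  finally show ?thesis .
qed

text \<open>The disc is cut into the annuli 1 - 2^-n \<le> |z| < 1 - 2^-(n+1). On the n-th one the
  weight is of size 2^(-n \<alpha>) and the area is of size 2^-n, so the integral is dominated by a
  geometric series of ratio 2^-(1+\<alpha>), which is below 1 because \<alpha> > -1.\<close>

lemma nn_integral_weight_finite:
  assumes \<alpha>: "-1 < \<alpha>"
  shows "(\<integral>\<^sup>+z. ennreal ((1 - (cmod z)\<^sup>2) powr \<alpha>) \<partial>disc_lborel) < \<infinity>"
proof -
  define q :: real where "q = 1 / 2"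
  define A where "A n = ball (0::complex) (1 - q ^ Suc n) - ball 0 (1 - q ^ n)" for n
  \<comment> \<open>On the annulus 1 - |z|^2 lies between q^n / 4 and 4 q^n. The upper bound serves
    \<alpha> \<ge> 0, the lower one \<alpha> < 0, and the constant
    \<open>4 powr \<bar>\<alpha>\<bar>\<close> fits both.\<close>
  have bound: "(1 - (cmod z)\<^sup>2) powr \<alpha> \<le> 4 powr \<bar>\<alpha>\<bar> * (q ^ n) powr \<alpha>" if "z \<in> A n" for z n
  proof -
    define t where "t = cmod z"
    have qn: "q ^ n > 0" "q ^ n \<le> 1" by (auto simp: q_def power_le_one)
    have t: "1 - q ^ n \<le> t" "t < 1 - q ^ n / 2" "0 \<le> t"
      using that by (auto simp: A_def t_def q_def)
    have eq: "1 - t\<^sup>2 = (1 - t) * (1 + t)" by (simp add: power2_eq_square algebra_simps)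
    have 1: "1 - t\<^sup>2 \<le> 4 * q ^ n"
    proof -
      have "(1 - t) * (1 + t) \<le> q ^ n * 2" using t qn by (intro mult_mono) auto
      then show ?thesis using qn eq by simp
    qed
    have 2: "q ^ n / 4 \<le> 1 - t\<^sup>2"
    proof -
      have "q ^ n / 2 * 1 \<le> (1 - t) * (1 + t)" using t qn by (intro mult_mono) auto
      then show ?thesis using qn eq by simp
    qed
    show ?thesis
    proof (cases "\<alpha> \<ge> 0")
      case True
      have "(1 - t\<^sup>2) powr \<alpha> \<le> (4 * q ^ n) powr \<alpha>"
        using True 1 2 qn by (intro powr_mono2) auto
      then show ?thesis using True qn by (simp add: powr_mult t_def)
    next
      case False
      have "(1 - t\<^sup>2) powr \<alpha> \<le> (q ^ n / 4) powr \<alpha>"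
        using False 2 qn by (intro powr_mono2') auto
      then show ?thesis using False qn by (simp add: powr_divide powr_minus_divide t_def)
    qed
  qed
  have cover: "unit_disc \<subseteq> (\<Union>n. A n)"
  proof
    fix z :: complex assume "z \<in> unit_disc"
    then have z: "cmod z < 1" by simp
    obtain m where "q ^ m < 1 - cmod z"
      using real_arch_pow_inv[of "1 - cmod z" q] z by (auto simp: q_def)
    then have ex: "cmod z < 1 - q ^ m" by simp
    \<comment> \<open>The least such \<open>k\<close> is not 0, since 1 - q^0 = 0; its predecessor
      is the index of the annulus containing \<open>z\<close>.\<close>
    define k where "k = (LEAST m. cmod z < 1 - q ^ m)"
    have k: "cmod z < 1 - q ^ k" unfolding k_def by (rule LeastI[of _ m]) (rule ex)
    then have "k \<noteq> 0" by (intro notI) auto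
    then obtain n where n: "k = Suc n" by (cases k) auto
    have "\<not> cmod z < 1 - q ^ n"
      using not_less_Least[of n "\<lambda>m. cmod z < 1 - q ^ m"] n k_def by auto
    then have "z \<in> A n" using k n by (auto simp: A_def)
    then show "z \<in> (\<Union>n. A n)" by blast
  qed
  have meas [measurable]: "A n \<in> sets borel" for n by (auto simp: A_def)
  have "(\<integral>\<^sup>+z. ennreal ((1 - (cmod z)\<^sup>2) powr \<alpha>) \<partial>disc_lborel)
      = (\<integral>\<^sup>+z. ennreal ((1 - (cmod z)\<^sup>2) powr \<alpha>) * indicator unit_disc z \<partial>lborel)"
    by (subst nn_integral_restrict_space) auto
  also have "\<dots> \<le> (\<integral>\<^sup>+z. (\<Sum>n. ennreal (4 powr \<bar>\<alpha>\<bar> * (q ^ n) powr \<alpha>) * indicator (A n) z) \<partial>lborel)"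
  proof (rule nn_integral_mono)
    fix z :: complex
    show "ennreal ((1 - (cmod z)\<^sup>2) powr \<alpha>) * indicator unit_disc z
      \<le> (\<Sum>n. ennreal (4 powr \<bar>\<alpha>\<bar> * (q ^ n) powr \<alpha>) * indicator (A n) z)"
    proof (cases "z \<in> unit_disc")
      case True
      then obtain n where n: "z \<in> A n" using cover by blast
      have "ennreal ((1 - (cmod z)\<^sup>2) powr \<alpha>) \<le> ennreal (4 powr \<bar>\<alpha>\<bar> * (q ^ n) powr \<alpha>) * indicator (A n) z"
        using bound[OF n] n by (simp add: ennreal_leI)
      also have "\<dots> \<le> (\<Sum>n. ennreal (4 powr \<bar>\<alpha>\<bar> * (q ^ n) powr \<alpha>) * indicator (A n) z)"
        using sum_le_suminf[of "\<lambda>n. ennreal (4 powr \<bar>\<alpha>\<bar> * (q ^ n) powr \<alpha>) * indicator (A n) z" "{n}"]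
        by (simp del: sum_mult_indicator)
      finally show ?thesis using True by simp
    qed simp
  qed
  also have "\<dots> = (\<Sum>n. ennreal (4 powr \<bar>\<alpha>\<bar> * (q ^ n) powr \<alpha>) * emeasure lborel (A n))"
    by (subst nn_integral_suminf) (auto simp: nn_integral_cmult_indicator)
  also have "\<dots> \<le> (\<Sum>n. ennreal (4 powr \<bar>\<alpha>\<bar> * pi * (q powr (1 + \<alpha>)) ^ n))"
  proof (intro suminf_le)
    fix n
    have "emeasure lborel (A n) \<le> ennreal (2 * pi * (1 - q ^ Suc n - (1 - q ^ n)))"
      unfolding A_def by (rule emeasure_annulus_le) (auto simp: q_def power_le_one field_simps)
    also have "2 * pi * (1 - q ^ Suc n - (1 - q ^ n)) = pi * q ^ n"
      by (simp add: q_def)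
    finally have "ennreal (4 powr \<bar>\<alpha>\<bar> * (q ^ n) powr \<alpha>) * emeasure lborel (A n)
        \<le> ennreal (4 powr \<bar>\<alpha>\<bar> * (q ^ n) powr \<alpha>) * ennreal (pi * q ^ n)"
      by (intro mult_left_mono) auto
    also have "\<dots> = ennreal (4 powr \<bar>\<alpha>\<bar> * pi * ((q ^ n) powr 1 * (q ^ n) powr \<alpha>))"
      by (simp add: ennreal_mult' [symmetric] q_def)
    also have "(q ^ n) powr 1 * (q ^ n) powr \<alpha> = (q powr (1 + \<alpha>)) ^ n"
      by (simp add: powr_add [symmetric] q_def powr_powr powr_power algebra_simps flip: powr_realpow)
    finally show "ennreal (4 powr \<bar>\<alpha>\<bar> * (q ^ n) powr \<alpha>) * emeasure lborel (A n)
        \<le> ennreal (4 powr \<bar>\<alpha>\<bar> * pi * (q powr (1 + \<alpha>)) ^ n)" .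
  qed auto
  also have "\<dots> < \<infinity>"
  proof -
    have "q powr (1 + \<alpha>) < 1 powr (1 + \<alpha>)"
      using \<alpha> by (intro powr_less_mono2) (auto simp: q_def)
    then have "summable (\<lambda>n. 4 powr \<bar>\<alpha>\<bar> * pi * (q powr (1 + \<alpha>)) ^ n)"
      by (intro summable_mult summable_geometric) auto
    then show ?thesis
      by (subst suminf_ennreal2) auto
  qed
  finally show ?thesis .
qed

lemma finite_weighted_area:
  assumes \<alpha>: "-1 < \<alpha>"
  shows "finite_measure (weighted_area \<alpha>)"
proof
  have "emeasure (weighted_area \<alpha>) (space (weighted_area \<alpha>)) = (\<integral>\<^sup>+z. ennreal (weight \<alpha> z) \<partial>disc_lborel)"
    unfolding weighted_area_eq
    by (subst emeasure_density)
       (auto intro!: measurable_restrict_space1 nn_integral_cong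
          simp: space_restrict_space sets_restrict_space_iff indicator_def)
  also have "\<dots> = (\<integral>\<^sup>+z. ennreal ((1 + \<alpha>) / pi) * ennreal ((1 - (cmod z)\<^sup>2) powr \<alpha>) \<partial>disc_lborel)"
    using \<alpha> by (intro nn_integral_cong) (simp add: weight_def ennreal_mult' [symmetric])
  also have "\<dots> = ennreal ((1 + \<alpha>) / pi) * (\<integral>\<^sup>+z. ennreal ((1 - (cmod z)\<^sup>2) powr \<alpha>) \<partial>disc_lborel)"
    by (intro nn_integral_cmult measurable_restrict_space1) auto
  also have "\<dots> < \<infinity>"
    using nn_integral_weight_finite[OF \<alpha>] by (simp add: ennreal_mult_less_top)
  finally show "emeasure (weighted_area \<alpha>) (space (weighted_area \<alpha>)) \<noteq> \<infinity>" by simp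
qed

text \<open>The density is strictly positive on the disc, so total mass 0 would make the disc
  Lebesgue null, while its area is pi. Positivity allows division by the mass in the estimate of the
  residuals.\<close>

lemma measure_weighted_area_pos:
  assumes \<alpha>: "-1 < \<alpha>"
  shows "measure (weighted_area \<alpha>) unit_disc > 0"
proof -
  interpret finite_measure "weighted_area \<alpha>" by (rule finite_weighted_area[OF \<alpha>])
  have meas [measurable]: "(\<lambda>z. ennreal (weight \<alpha> z)) \<in> borel_measurable disc_lborel"
    by (intro measurable_restrict_space1) simp
  have [measurable]: "unit_disc \<in> sets disc_lborel"
    by (simp add: sets_restrict_space_iff)
  have "emeasure (weighted_area \<alpha>) unit_disc \<noteq> 0"
  proof
    assume "emeasure (weighted_area \<alpha>) unit_disc = 0"
    then have "(\<integral>\<^sup>+z. ennreal (weight \<alpha> z) * indicator unit_disc z \<partial>disc_lborel) = 0"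
      unfolding weighted_area_eq by (subst (asm) emeasure_density)
        auto
    then have "AE z in disc_lborel. ennreal (weight \<alpha> z) * indicator unit_disc z = 0"
      by (subst (asm) nn_integral_0_iff_AE) auto
    moreover have "AE z in disc_lborel. z \<in> unit_disc"
      by (rule AE_I2) (simp add: space_restrict_space)
    ultimately have "AE z in disc_lborel. False"
    proof eventually_elim
      case (elim z)
      have "(cmod z)\<^sup>2 < 1" using elim(2) by (simp add: power_less_one_iff)
      then have "weight \<alpha> z > 0" using \<alpha> by (auto simp: weight_def)
      with elim show False by simp
    qed
    then have "emeasure disc_lborel (space disc_lborel) = 0"
      by (metis AE_iff_null_sets Collect_mem_eq ae_filter_eq_bot_iff eventually_False)
    then have "emeasure lborel unit_disc = 0"
      by (simp add: space_restrict_space emeasure_restrict_space)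
    then show False by (simp add: emeasure_ball unit_ball_vol_2)
  qed
  then show ?thesis
    by (simp add: emeasure_eq_measure zero_less_measure_iff)
qed

section \<open>The reproducing property\<close>

text \<open>Cauchy's formula at the centre for the map u -> G (z u), whose argument stays in the
  disc for |u| \<le> 1 because |z| < 1. On the unit circle du / u = 2 pi i dt, so the constant
  cancels.\<close>

lemma circle_mean_has_integral:
  assumes G: "G holomorphic_on unit_disc" and z: "z \<in> unit_disc"
  shows "((\<lambda>t. G (z * exp (2 * pi * \<i> * of_real t))) has_integral G 0) {0..1}"
proof -
  have sub: "z * u \<in> unit_disc" if "cmod u \<le> 1" for u
  proof -
    have "cmod z * cmod u \<le> cmod z * 1" using that by (intro mult_left_mono) auto
    with z show ?thesis by (simp add: norm_mult)
  qed
  have "(\<lambda>u. G (z * u)) holomorphic_on cball 0 1"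
    using holomorphic_on_compose_gen[of "\<lambda>u. z * u" "cball 0 1" G unit_disc] G sub
    by (force simp: o_def intro!: holomorphic_intros)
  then have "((\<lambda>u. G (z * u) / (u - 0)) has_contour_integral (2 * of_real pi * \<i> * G (z * 0))) (circlepath 0 1)"
    by (intro Cauchy_integral_circlepath)
       (auto intro: holomorphic_on_imp_continuous_on elim: holomorphic_on_subset)
  then have *: "((\<lambda>t. G (z * circlepath 0 1 t) / (circlepath 0 1 t - 0) * vector_derivative (circlepath 0 1) (at t within {0..1}))
      has_integral (2 * of_real pi * \<i> * G (z * 0))) {0..1}"
    unfolding has_contour_integral_def .
  define c where "c = 2 * of_real pi * \<i>"
  have c: "c \<noteq> 0" by (simp add: c_def)
  have "((\<lambda>t. c * G (z * exp (2 * pi * \<i> * of_real t))) has_integral (c * G (z * 0))) {0..1}"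
  proof (rule has_integral_eq[OF _ *[folded c_def]])
    fix t :: real assume "t \<in> {0..1}"
    then show "G (z * circlepath 0 1 t) / (circlepath 0 1 t - 0) * vector_derivative (circlepath 0 1) (at t within {0..1})
      = c * G (z * exp (2 * pi * \<i> * of_real t))"
      by (simp add: vector_derivative_circlepath01 c_def) (simp add: circlepath mult_ac)
  qed
  from has_integral_mult_right[OF this, of "inverse c"] show ?thesis
    using c by (simp flip: mult.assoc)
qed

lemma weighted_area_rotation:
  fixes F :: "complex \<Rightarrow> 'b :: {banach, second_countable_topology}"
  assumes "-1 < \<alpha>" "cmod u = 1" "continuous_on unit_disc F"
  shows "integrable (weighted_area \<alpha>) F \<longleftrightarrow> integrable (weighted_area \<alpha>) (\<lambda>z. F (z * u))"
    and "integral\<^sup>L (weighted_area \<alpha>) F = integral\<^sup>L (weighted_area \<alpha>) (\<lambda>z. F (z * u))"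
proof -
  have "u \<noteq> 0" using assms by auto
  then have bij: "bij_betw (\<lambda>z. z * u) unit_disc unit_disc"
    using assms by (intro bij_betwI[where g = "\<lambda>z. z / u"]) (auto simp: norm_mult norm_divide)
  have der: "((\<lambda>z. z * u) has_field_derivative u) (at z)" for z
    by (auto intro!: derivative_eq_intros)
  show "integrable (weighted_area \<alpha>) F \<longleftrightarrow> integrable (weighted_area \<alpha>) (\<lambda>z. F (z * u))"
    using weighted_area_automorphism(1)[of \<alpha> "\<lambda>z. z * u" "\<lambda>_. u" "\<lambda>_. 1" F] assms bij der
    by (simp add: weight_def norm_mult)
  show "integral\<^sup>L (weighted_area \<alpha>) F = integral\<^sup>L (weighted_area \<alpha>) (\<lambda>z. F (z * u))"
    using weighted_area_automorphism(2)[of \<alpha> "\<lambda>z. z * u" "\<lambda>_. u" "\<lambda>_. 1" F] assms bij der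
    by (simp add: weight_def norm_mult)
qed

text \<open>The measure is invariant under rotations, so \<open>G\<close> may be replaced by its
  average over all of them. By Fubini the average is taken first along circles, where the mean value
  property gives \<open>G 0\<close>.\<close>

lemma integral_weighted_area_holomorphic:
  assumes \<alpha>: "-1 < \<alpha>" and G: "G holomorphic_on unit_disc"
    and int: "integrable (weighted_area \<alpha>) G"
  shows "integral\<^sup>L (weighted_area \<alpha>) G = of_real (measure (weighted_area \<alpha>) unit_disc) * G 0"
proof -
  define \<mu> where "\<mu> = weighted_area \<alpha>"
  define I where "I = restrict_space lborel {0..1::real}"
  define e where "e t = exp (2 * pi * \<i> * complex_of_real t)" for t
  \<comment> \<open>\<open>G\<close> is arbitrary outside the disc. Extended by 0 it is Borel on the
    plane, which makes \<open>G' (z * e t)\<close> jointly measurable in \<open>t\<close> and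
    \<open>z\<close>.\<close>
  define G' where "G' z = indicator unit_disc z *\<^sub>R G z" for z
  have contG: "continuous_on unit_disc G" using G by (rule holomorphic_on_imp_continuous_on)
  have ne: "cmod (e t) = 1" for t by (simp add: e_def)
  interpret \<mu>: finite_measure \<mu> unfolding \<mu>_def by (rule finite_weighted_area[OF \<alpha>])
  interpret I: finite_measure I
    by standard (simp add: I_def space_restrict_space emeasure_restrict_space)
  interpret P: pair_sigma_finite I \<mu> ..
  have [measurable]: "G' \<in> borel_measurable borel"
    unfolding G'_def by (intro borel_measurable_continuous_on_indicator contG) auto
  have [measurable]: "e \<in> borel_measurable I"
    unfolding I_def e_def by (intro measurable_restrict_space1) simp
  have [measurable]: "(\<lambda>z. z) \<in> \<mu> \<rightarrow>\<^sub>M borel"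
    unfolding \<mu>_def by (intro continuous_on_disc_measurable continuous_on_id)
  have sp: "space \<mu> = unit_disc" by (simp add: \<mu>_def)
  have G'G: "G' (z * e t) = G (z * e t)" if "z \<in> unit_disc" for z t
    using that ne by (simp add: G'_def norm_mult)
  have inner: "integrable \<mu> (\<lambda>z. G' (z * e t))"
      "integral\<^sup>L \<mu> (\<lambda>z. G' (z * e t)) = integral\<^sup>L \<mu> G"
      "integral\<^sup>L \<mu> (\<lambda>z. cmod (G' (z * e t))) = integral\<^sup>L \<mu> (\<lambda>z. cmod (G z))" for t
  proof -
    show "integrable \<mu> (\<lambda>z. G' (z * e t))"
      using weighted_area_rotation(1)[OF \<alpha> ne contG, of t] int
      by (subst Bochner_Integration.integrable_cong[OF refl, of _ _ "\<lambda>z. G (z * e t)"]) (auto simp: \<mu>_def G'G)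
    show "integral\<^sup>L \<mu> (\<lambda>z. G' (z * e t)) = integral\<^sup>L \<mu> G"
      using weighted_area_rotation(2)[OF \<alpha> ne contG, of t]
      by (subst Bochner_Integration.integral_cong[OF refl, of _ _ "\<lambda>z. G (z * e t)"]) (auto simp: \<mu>_def G'G)
    show "integral\<^sup>L \<mu> (\<lambda>z. cmod (G' (z * e t))) = integral\<^sup>L \<mu> (\<lambda>z. cmod (G z))"
      using weighted_area_rotation(2)[OF \<alpha> ne continuous_on_norm[OF contG], of t]
      by (subst Bochner_Integration.integral_cong[OF refl, of _ _ "\<lambda>z. cmod (G (z * e t))"]) (auto simp: \<mu>_def G'G)
  qed
  \<comment> \<open>By rotation invariance the integral of the modulus over \<open>z\<close> does
    not depend on \<open>t\<close>, and \<open>I\<close> has finite mass.\<close>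
  have "integrable (I \<Otimes>\<^sub>M \<mu>) (\<lambda>(t, z). G' (z * e t))"
  proof (rule P.Fubini_integrable)
    show "(\<lambda>(t, z). G' (z * e t)) \<in> borel_measurable (I \<Otimes>\<^sub>M \<mu>)"
      by measurable
  qed (auto simp: inner)
  then have "(\<integral>z. (\<integral>t. G' (z * e t) \<partial>I) \<partial>\<mu>) = (\<integral>t. (\<integral>z. G' (z * e t) \<partial>\<mu>) \<partial>I)"
    by (rule P.Fubini_integral)
  also have "\<dots> = integral\<^sup>L \<mu> G"
    by (simp add: inner I_def measure_restrict_space space_restrict_space)
  also have "(\<integral>z. (\<integral>t. G' (z * e t) \<partial>I) \<partial>\<mu>) = (\<integral>z. G 0 \<partial>\<mu>)"
  proof (rule Bochner_Integration.integral_cong[OF refl])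
    fix z assume "z \<in> space \<mu>"
    then have z: "z \<in> unit_disc" by (simp add: sp)
    have cont: "continuous_on {0..1} (\<lambda>t. G (z * e t))"
      unfolding e_def using z ne[unfolded e_def]
      by (intro continuous_on_compose2[OF contG] continuous_intros) (auto simp: norm_mult)
    have "(\<integral>t. G' (z * e t) \<partial>I) = (\<integral>t. G (z * e t) \<partial>I)"
      by (intro Bochner_Integration.integral_cong refl G'G z)
    also have "\<dots> = set_lebesgue_integral lborel {0..1} (\<lambda>t. G (z * e t))"
      unfolding I_def set_lebesgue_integral_def by (subst integral_restrict_space) auto
    also have "\<dots> = integral {0..1} (\<lambda>t. G (z * e t))"
      by (intro set_borel_integral_eq_integral borel_integrable_atLeastAtMost' cont)
    also have "\<dots> = G 0"
      using circle_mean_has_integral[OF G z] unfolding e_def by (rule integral_unique)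
    finally show "(\<integral>t. G' (z * e t) \<partial>I) = G 0" .
  qed
  finally show ?thesis
    by (simp add: \<mu>_def scaleR_conv_of_real)
qed

section \<open>The disc involution and its action on weight and kernel\<close>

text \<open>For \<open>b\<close> in the disc this is the Moebius automorphism of the disc that
  exchanges 0 and \<open>b\<close>; it is its own inverse.\<close>

definition disc_involution :: "complex \<Rightarrow> complex \<Rightarrow> complex" where
  "disc_involution b z = (b - z) / (1 - cnj b * z)"

context
  fixes b :: complex assumes b: "b \<in> unit_disc"
begin

text \<open>Positive real part keeps the base of the kernel away from 0 and from the branch cut of
  \<open>powr\<close>. The boundary |z| = 1 is included so that kernels can later be bounded by
  compactness of the closed disc.\<close>

lemma Re_one_minus_cnj_mult_pos:
  assumes "cmod z \<le> 1" shows "Re (1 - cnj b * z) > 0"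
proof -
  have "Re (cnj b * z) \<le> cmod (cnj b * z)" by (rule complex_Re_le_cmod)
  also have "\<dots> \<le> cmod b * 1" unfolding norm_mult using assms by (intro mult_mono) auto
  also have "\<dots> < 1" using b by simp
  finally show ?thesis by simp
qed

lemma one_minus_cnj_mult_nonzero: "cmod z \<le> 1 \<Longrightarrow> 1 - cnj b * z \<noteq> 0"
  using Re_one_minus_cnj_mult_pos[of z] by (metis less_irrefl zero_complex.sel(1))

lemma one_minus_cnj_mult_notin_nonpos: "cmod z \<le> 1 \<Longrightarrow> 1 - cnj b * z \<notin> \<real>\<^sub>\<le>\<^sub>0"
  using Re_one_minus_cnj_mult_pos[of z] by (auto simp: complex_nonpos_Reals_iff)

lemma norm_b_square_less: "(cmod b)\<^sup>2 < 1"
  using b by (simp add: power_less_one_iff)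

text \<open>Rests on the identity |1 - cnj b z|^2 - |b - z|^2 = (1 - |b|^2) (1 - |z|^2). It yields
  both the invariance of the disc and the transformation of the weight.\<close>

lemma one_minus_norm_disc_involution:
  assumes z: "cmod z < 1"
  shows "1 - (cmod (disc_involution b z))\<^sup>2 = (1 - (cmod b)\<^sup>2) * (1 - (cmod z)\<^sup>2) / (cmod (1 - cnj b * z))\<^sup>2"
proof -
  have nz: "1 - cnj b * z \<noteq> 0" using z by (intro one_minus_cnj_mult_nonzero) auto
  have "complex_of_real ((cmod (1 - cnj b * z))\<^sup>2 - (cmod (b - z))\<^sup>2) = of_real ((1 - (cmod b)\<^sup>2) * (1 - (cmod z)\<^sup>2))"
    by (simp only: of_real_diff of_real_mult complex_norm_square of_real_1 complex_cnj_diff complex_cnj_mult complex_cnj_cnj complex_cnj_one)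
       (simp add: algebra_simps)
  then have "(cmod (1 - cnj b * z))\<^sup>2 - (cmod (b - z))\<^sup>2 = (1 - (cmod b)\<^sup>2) * (1 - (cmod z)\<^sup>2)"
    by (simp only: of_real_eq_iff)
  then show ?thesis
    using nz by (simp add: disc_involution_def norm_divide power_divide field_simps)
qed

lemma disc_involution_in_disc:
  assumes "z \<in> unit_disc" shows "disc_involution b z \<in> unit_disc"
proof -
  have z: "cmod z < 1" using assms by simp
  have "1 - (cmod (disc_involution b z))\<^sup>2 > 0"
    unfolding one_minus_norm_disc_involution[OF z]
    using norm_b_square_less z one_minus_cnj_mult_nonzero[of z]
    by (intro divide_pos_pos mult_pos_pos) (auto simp: power_less_one_iff)
  then show ?thesis by (simp add: power_less_one_iff)
qed

lemma one_minus_cnj_mult_disc_involution: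
  assumes "z \<in> unit_disc"
  shows "1 - cnj b * disc_involution b z = of_real (1 - (cmod b)\<^sup>2) / (1 - cnj b * z)"
  using one_minus_cnj_mult_nonzero[of z] assms
  by (simp add: disc_involution_def field_simps complex_norm_square[symmetric] flip: of_real_power)

lemma disc_involution_involution:
  assumes "z \<in> unit_disc" shows "disc_involution b (disc_involution b z) = z"
proof -
  have nz: "1 - cnj b * z \<noteq> 0" using assms by (intro one_minus_cnj_mult_nonzero) auto
  have nz': "1 - b * cnj b \<noteq> 0"
    using norm_b_square_less complex_norm_square[of b]
    by (metis eq_iff_diff_eq_0 less_irrefl of_real_1 of_real_eq_iff)
  have "disc_involution b (disc_involution b z) = (b - disc_involution b z) / (of_real (1 - (cmod b)\<^sup>2) / (1 - cnj b * z))"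
    unfolding one_minus_cnj_mult_disc_involution[OF assms, symmetric] by (simp add: disc_involution_def)
  also have "b - disc_involution b z = z * (1 - b * cnj b) / (1 - cnj b * z)"
    using nz by (simp add: disc_involution_def field_simps)
  also have "of_real (1 - (cmod b)\<^sup>2) = 1 - b * cnj b"
    by (simp only: of_real_diff complex_norm_square of_real_1)
  finally show ?thesis using nz nz' by simp
qed

lemma bij_betw_disc_involution: "bij_betw (disc_involution b) unit_disc unit_disc"
  by (rule bij_betwI[where g = "disc_involution b"])
     (use disc_involution_in_disc disc_involution_involution in blast)+

lemma disc_involution_has_field_derivative:
  assumes "z \<in> unit_disc"
  shows "(disc_involution b has_field_derivative (- of_real (1 - (cmod b)\<^sup>2) / (1 - cnj b * z)\<^sup>2)) (at z)"
proof -
  have nz: "1 - cnj b * z \<noteq> 0" using assms by (intro one_minus_cnj_mult_nonzero) auto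
  have eq: "complex_of_real (1 - (cmod b)\<^sup>2) = 1 - b * cnj b"
    by (simp only: of_real_diff complex_norm_square of_real_1)
  have "(disc_involution b has_field_derivative
      ((0 - 1) * (1 - cnj b * z) - (b - z) * (0 - cnj b)) / ((1 - cnj b * z) * (1 - cnj b * z))) (at z)"
    unfolding disc_involution_def using nz
    by (intro DERIV_divide DERIV_diff DERIV_const DERIV_ident DERIV_cmult_Id)
  also have "(0 - 1) * (1 - cnj b * z) - (b - z) * (0 - cnj b) = - of_real (1 - (cmod b)\<^sup>2)"
    unfolding eq by (simp add: algebra_simps)
  finally show ?thesis by (simp add: power2_eq_square)
qed

lemma norm_powr_of_real: "y \<noteq> 0 \<Longrightarrow> cmod (y powr of_real c) = cmod y powr c"
  by (simp add: powr_def)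

text \<open>The base of the kernel becomes r / y with r = 1 - |b|^2 and y = 1 - cnj b z. As r > 0
  and y avoids the branch cut, \<open>Ln\<close> of the quotient is ln r - Ln y, so the principal
  power of the quotient splits.\<close>

lemma bergman_kernel_disc_involution:
  assumes z: "z \<in> unit_disc"
  shows "bergman_kernel \<alpha> b (disc_involution b z)
    = (1 - cnj b * z) powr of_real (2 + \<alpha>) / of_real ((1 - (cmod b)\<^sup>2) powr (2 + \<alpha>))"
proof -
  define y where "y = 1 - cnj b * z"
  define r where "r = 1 - (cmod b)\<^sup>2"
  have y: "y \<notin> \<real>\<^sub>\<le>\<^sub>0" "y \<noteq> 0" unfolding y_def
    using z one_minus_cnj_mult_notin_nonpos[of z] one_minus_cnj_mult_nonzero[of z] by auto
  have r: "r > 0" using norm_b_square_less by (simp add: r_def)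
  have "Ln (of_real r / y) = of_real (ln r) - Ln y"
  proof -
    have "Ln (of_real r * inverse y) = of_real (ln r) + Ln (inverse y)"
      using r y by (simp add: Ln_times_of_real Ln_of_real)
    with y show ?thesis by (simp add: Ln_inverse divide_inverse)
  qed
  then have "(of_real r / y) powr of_real (2 + \<alpha>) = of_real r powr of_real (2 + \<alpha>) / y powr of_real (2 + \<alpha>)"
    using r y by (simp add: powr_def right_diff_distrib exp_diff Ln_of_real)
  then show ?thesis
    using r unfolding bergman_kernel_def one_minus_cnj_mult_disc_involution[OF z] y_def[symmetric] r_def[symmetric]
    by (simp add: powr_of_real del: of_real_add)
qed

text \<open>With r = 1 - |b|^2 and Y = |1 - cnj b z|^2, the squared derivative contributes (r / Y)^2
  and the weight contributes (r / Y)^\<alpha>; this is where the exponent 2 + \<alpha> of the kernel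
  comes from.\<close>

lemma weight_disc_involution:
  assumes z: "z \<in> unit_disc"
  shows "(cmod (- of_real (1 - (cmod b)\<^sup>2) / (1 - cnj b * z)\<^sup>2))\<^sup>2 * weight \<alpha> (disc_involution b z)
    = weight \<alpha> z * ((1 - (cmod b)\<^sup>2) / (cmod (1 - cnj b * z))\<^sup>2) powr (2 + \<alpha>)"
proof -
  define Y where "Y = (cmod (1 - cnj b * z))\<^sup>2"
  define r where "r = 1 - (cmod b)\<^sup>2"
  have Y: "Y > 0" using z one_minus_cnj_mult_nonzero[of z] by (simp add: Y_def)
  have r: "r > 0" using norm_b_square_less by (simp add: r_def)
  have z1: "cmod z < 1" using z by simp
  have "(cmod (- of_real r / (1 - cnj b * z)\<^sup>2))\<^sup>2 = (r / Y)\<^sup>2"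
    using r by (simp add: norm_divide norm_power Y_def)
  also have "\<dots> = (r / Y) powr 2"
    using r Y by simp
  moreover have "weight \<alpha> (disc_involution b z) = weight \<alpha> z * (r / Y) powr \<alpha>"
  proof -
    have eq: "r * (1 - (cmod z)\<^sup>2) / Y = (1 - (cmod z)\<^sup>2) * (r / Y)" by simp
    have "1 - (cmod z)\<^sup>2 \<ge> 0" using z1 by (simp add: power_le_one)
    then have "(r * (1 - (cmod z)\<^sup>2) / Y) powr \<alpha> = (1 - (cmod z)\<^sup>2) powr \<alpha> * (r / Y) powr \<alpha>"
      unfolding eq using r Y by (subst powr_mult) auto
    then show ?thesis
      unfolding weight_def one_minus_norm_disc_involution[OF z1] r_def[symmetric] Y_def[symmetric] by simp
  qed
  ultimately show ?thesis
    unfolding Y_def[symmetric] r_def[symmetric] powr_add by simp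
qed

text \<open>Under the disc involution the integrand of the inner product becomes the function
  \<open>G\<close>: the powers of 1 - |b|^2 cancel, and the conjugate factor of the kernel cancels
  against half of the squared modulus in \<open>J\<close>. Thus \<open>G\<close> is holomorphic, and
  its mean value is \<open>G 0\<close>, which equals \<open>h b\<close>.\<close>

lemma bergman_reproducing:
  assumes \<alpha>: "-1 < \<alpha>" and h: "h holomorphic_on unit_disc"
    and int: "integrable (weighted_area \<alpha>) (\<lambda>z. h z * cnj (bergman_kernel \<alpha> b z))"
  shows "bergman_inner \<alpha> h (bergman_kernel \<alpha> b) = of_real (measure (weighted_area \<alpha>) unit_disc) * h b"
proof -
  define \<phi> where "\<phi> = disc_involution b"
  define r where "r = 1 - (cmod b)\<^sup>2"
  define G where "G z = h (\<phi> z) / (1 - cnj b * z) powr of_real (2 + \<alpha>)" for z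
  define J where "J z = (r / (cmod (1 - cnj b * z))\<^sup>2) powr (2 + \<alpha>)" for z
  define F where "F z = h z * cnj (bergman_kernel \<alpha> b z)" for z
  have r: "r > 0" using norm_b_square_less by (simp add: r_def)
  have nz: "1 - cnj b * z \<noteq> 0" "1 - cnj b * z \<notin> \<real>\<^sub>\<le>\<^sub>0" if "z \<in> unit_disc" for z
    using that one_minus_cnj_mult_notin_nonpos[of z] one_minus_cnj_mult_nonzero[of z] by auto
  have \<phi>_hol: "\<phi> holomorphic_on unit_disc"
    using nz unfolding \<phi>_def disc_involution_def[abs_def] by (intro holomorphic_intros) auto
  have G_hol: "G holomorphic_on unit_disc"
    unfolding G_def using nz disc_involution_in_disc
    by (intro holomorphic_intros holomorphic_on_compose_gen[OF \<phi>_hol h, unfolded o_def])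
       (auto simp: \<phi>_def)
  have cont_h: "continuous_on unit_disc h" using h by (rule holomorphic_on_imp_continuous_on)
  have "bergman_kernel \<alpha> b holomorphic_on unit_disc"
    unfolding bergman_kernel_def[abs_def] using nz by (intro holomorphic_intros) auto
  then have contF: "continuous_on unit_disc F"
    unfolding F_def by (intro continuous_intros cont_h holomorphic_on_imp_continuous_on)
  have contJ: "continuous_on unit_disc J"
    unfolding J_def using nz r by (intro continuous_intros) auto
  have eq: "J z *\<^sub>R F (\<phi> z) = G z" if z: "z \<in> unit_disc" for z
  proof -
    define y where "y = (1 - cnj b * z) powr of_real (2 + \<alpha>)"
    have y: "y \<noteq> 0" using nz[OF z] by (simp add: y_def)
    have "J z = r powr (2 + \<alpha>) / (cmod y)\<^sup>2"
      unfolding J_def y_def norm_powr_of_real[OF nz(1)[OF z]] using r nz(1)[OF z]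
      by (simp add: powr_divide power2_eq_square powr_mult)
    moreover have "F (\<phi> z) = h (\<phi> z) * cnj y / of_real (r powr (2 + \<alpha>))"
      unfolding F_def \<phi>_def bergman_kernel_disc_involution[OF z] y_def r_def by simp
    moreover have "complex_of_real ((cmod y)\<^sup>2) = y * cnj y" by (rule complex_norm_square)
    ultimately show ?thesis
      using y r unfolding G_def y_def[symmetric]
      by (simp add: scaleR_conv_of_real del: of_real_power)
  qed
  have cont': "continuous_on unit_disc (\<lambda>z. - of_real (1 - (cmod b)\<^sup>2) / (1 - cnj b * z)\<^sup>2)"
    using nz by (intro continuous_intros) auto
  have der: "(\<phi> has_field_derivative (- of_real (1 - (cmod b)\<^sup>2) / (1 - cnj b * z)\<^sup>2)) (at z)" if "z \<in> unit_disc" for z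
    unfolding \<phi>_def by (rule disc_involution_has_field_derivative[OF that])
  have J: "(cmod (- of_real (1 - (cmod b)\<^sup>2) / (1 - cnj b * z)\<^sup>2))\<^sup>2 * weight \<alpha> (\<phi> z) = weight \<alpha> z * J z"
    if "z \<in> unit_disc" for z
    unfolding \<phi>_def J_def r_def by (rule weight_disc_involution[OF that])
  have bij: "bij_betw \<phi> unit_disc unit_disc" unfolding \<phi>_def by (rule bij_betw_disc_involution)
  note A = weighted_area_automorphism[OF \<alpha> der cont' bij J contJ contF]
  have G_int: "integrable (weighted_area \<alpha>) G"
    using A(1) int unfolding F_def[symmetric]
    by (subst Bochner_Integration.integrable_cong[OF refl, of _ _ "\<lambda>z. J z *\<^sub>R F (\<phi> z)"]) (auto simp: eq)
  have "bergman_inner \<alpha> h (bergman_kernel \<alpha> b) = integral\<^sup>L (weighted_area \<alpha>) F"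
    by (simp add: bergman_inner_def F_def[abs_def])
  also have "\<dots> = integral\<^sup>L (weighted_area \<alpha>) (\<lambda>z. J z *\<^sub>R F (\<phi> z))"
    by (rule A(2))
  also have "\<dots> = integral\<^sup>L (weighted_area \<alpha>) G"
    by (intro Bochner_Integration.integral_cong refl) (simp add: eq)
  also have "\<dots> = of_real (measure (weighted_area \<alpha>) unit_disc) * G 0"
    by (rule integral_weighted_area_holomorphic[OF \<alpha> G_hol G_int])
  also have "G 0 = h b" by (simp add: G_def \<phi>_def disc_involution_def)
  finally show ?thesis .
qed

end

section \<open>Orthogonal expansions in the Bergman space\<close>

lemma bergman_space_holomorphic: "f \<in> bergman_space \<alpha> \<Longrightarrow> f holomorphic_on unit_disc"
  by (simp add: bergman_space_def)

lemma bergman_space_measurable: "f \<in> bergman_space \<alpha> \<Longrightarrow> f \<in> borel_measurable (weighted_area \<alpha>)"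
  by (intro continuous_on_disc_measurable holomorphic_on_imp_continuous_on bergman_space_holomorphic)

lemma bergman_space_mult_cnj_measurable:
  "f \<in> bergman_space \<alpha> \<Longrightarrow> g \<in> bergman_space \<alpha> \<Longrightarrow> (\<lambda>z. f z * cnj (g z)) \<in> borel_measurable (weighted_area \<alpha>)"
  by (intro continuous_on_disc_measurable continuous_intros holomorphic_on_imp_continuous_on
      bergman_space_holomorphic)

lemma bergman_space_integrable: "f \<in> bergman_space \<alpha> \<Longrightarrow> integrable (weighted_area \<alpha>) (\<lambda>z. (cmod (f z))\<^sup>2)"
  by (simp add: bergman_space_def)

lemma bergman_space_integrable_mult:
  assumes "f \<in> bergman_space \<alpha>" "g \<in> bergman_space \<alpha>"
  shows "integrable (weighted_area \<alpha>) (\<lambda>z. f z * cnj (g z))"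
proof (rule Bochner_Integration.integrable_bound)
  show "integrable (weighted_area \<alpha>) (\<lambda>z. (cmod (f z))\<^sup>2 + (cmod (g z))\<^sup>2)"
    by (intro Bochner_Integration.integrable_add bergman_space_integrable assms)
  show "(\<lambda>z. f z * cnj (g z)) \<in> borel_measurable (weighted_area \<alpha>)"
    by (intro bergman_space_mult_cnj_measurable assms)
  have "x * y \<le> x\<^sup>2 + y\<^sup>2" if "x \<ge> 0" "y \<ge> 0" for x y :: real
    using sum_squares_bound[of x y] mult_nonneg_nonneg[OF that] by linarith
  then show "AE z in weighted_area \<alpha>. norm (f z * cnj (g z)) \<le> norm ((cmod (f z))\<^sup>2 + (cmod (g z))\<^sup>2)"
    by (simp add: norm_mult)
qed

text \<open>The single operation f + c g covers sums, differences and scalar multiples; linearity of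
  the inner product and the expansion of the norm are stated for it as well.\<close>

lemma bergman_space_add_mult:
  assumes "f \<in> bergman_space \<alpha>" "g \<in> bergman_space \<alpha>"
  shows "(\<lambda>z. f z + c * g z) \<in> bergman_space \<alpha>"
proof -
  note bergman_space_measurable[OF assms(1), measurable] bergman_space_measurable[OF assms(2), measurable]
  have "integrable (weighted_area \<alpha>) (\<lambda>z. (cmod (f z + c * g z))\<^sup>2)"
  proof (rule Bochner_Integration.integrable_bound)
    show "integrable (weighted_area \<alpha>) (\<lambda>z. 2 * (cmod (f z))\<^sup>2 + 2 * (cmod c)\<^sup>2 * (cmod (g z))\<^sup>2)"
      by (intro Bochner_Integration.integrable_add Bochner_Integration.integrable_mult_right bergman_space_integrable assms)
    show "(\<lambda>z. (cmod (f z + c * g z))\<^sup>2) \<in> borel_measurable (weighted_area \<alpha>)"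
      by measurable
    have "(cmod (x + c * y))\<^sup>2 \<le> 2 * (cmod x)\<^sup>2 + 2 * (cmod c)\<^sup>2 * (cmod y)\<^sup>2" for x y
    proof -
      have "(cmod (x + c * y))\<^sup>2 \<le> (cmod x + cmod (c * y))\<^sup>2"
        by (intro power_mono norm_triangle_ineq) auto
      also have "\<dots> \<le> 2 * (cmod x)\<^sup>2 + 2 * (cmod (c * y))\<^sup>2"
        using sum_squares_bound[of "cmod x" "cmod (c * y)"] by (simp add: power2_sum)
      finally show ?thesis by (simp add: norm_mult power_mult_distrib)
    qed
    then show "AE z in weighted_area \<alpha>. norm ((cmod (f z + c * g z))\<^sup>2)
        \<le> norm (2 * (cmod (f z))\<^sup>2 + 2 * (cmod c)\<^sup>2 * (cmod (g z))\<^sup>2)"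
      by (intro AE_I2) auto
  qed
  then show ?thesis
    using assms by (auto simp: bergman_space_def intro!: holomorphic_intros)
qed

lemma bergman_space_zero: "(\<lambda>z. 0) \<in> bergman_space \<alpha>"
  by (simp add: bergman_space_def)

lemma bergman_space_mult: "f \<in> bergman_space \<alpha> \<Longrightarrow> (\<lambda>z. c * f z) \<in> bergman_space \<alpha>"
  using bergman_space_add_mult[OF bergman_space_zero, of f \<alpha> c] by simp

lemma bergman_space_sum:
  assumes "\<And>k. k \<in> A \<Longrightarrow> B k \<in> bergman_space \<alpha>"
  shows "(\<lambda>z. \<Sum>k\<in>A. c k * B k z) \<in> bergman_space \<alpha>"
proof (cases "finite A")
  case True
  then show ?thesis using assms
    by (induction A) (simp_all add: bergman_space_zero bergman_space_add_mult add.commute[of "c _ * _"])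
qed (simp add: bergman_space_zero)

lemma bergman_space_diff_sum:
  assumes "f \<in> bergman_space \<alpha>" "\<And>k. k \<in> A \<Longrightarrow> B k \<in> bergman_space \<alpha>"
  shows "(\<lambda>z. f z - (\<Sum>k\<in>A. c k * B k z)) \<in> bergman_space \<alpha>"
  using bergman_space_add_mult[OF assms(1), of "\<lambda>z. \<Sum>k\<in>A. c k * B k z" "-1"]
    bergman_space_sum[of A B, OF assms(2)] by simp

lemma bergman_inner_cnj: "cnj (bergman_inner \<alpha> f g) = bergman_inner \<alpha> g f"
  by (simp add: bergman_inner_def mult.commute flip: Bochner_Integration.integral_cnj)

lemma bergman_inner_add_mult:
  assumes "f \<in> bergman_space \<alpha>" "g \<in> bergman_space \<alpha>" "h \<in> bergman_space \<alpha>"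
  shows "bergman_inner \<alpha> (\<lambda>z. f z + c * g z) h = bergman_inner \<alpha> f h + c * bergman_inner \<alpha> g h"
proof -
  have "bergman_inner \<alpha> (\<lambda>z. f z + c * g z) h
      = (LINT z|weighted_area \<alpha>. f z * cnj (h z) + c * (g z * cnj (h z)))"
    by (simp add: bergman_inner_def algebra_simps)
  also have "\<dots> = bergman_inner \<alpha> f h + c * bergman_inner \<alpha> g h"
    unfolding bergman_inner_def using assms
    by (subst Bochner_Integration.integral_add)
       (auto intro!: bergman_space_integrable_mult Bochner_Integration.integrable_mult_right)
  finally show ?thesis .
qed

lemma bergman_inner_zero_left [simp]: "bergman_inner \<alpha> (\<lambda>z. 0) h = 0"
  and bergman_inner_zero_right [simp]: "bergman_inner \<alpha> h (\<lambda>z. 0) = 0"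
  by (simp_all add: bergman_inner_def)

lemma bergman_inner_mult_left:
  assumes "f \<in> bergman_space \<alpha>" "h \<in> bergman_space \<alpha>"
  shows "bergman_inner \<alpha> (\<lambda>z. c * f z) h = c * bergman_inner \<alpha> f h"
  using bergman_inner_add_mult[OF bergman_space_zero assms, of c] by simp

lemma bergman_inner_mult_right:
  assumes "f \<in> bergman_space \<alpha>" "h \<in> bergman_space \<alpha>"
  shows "bergman_inner \<alpha> h (\<lambda>z. c * f z) = cnj c * bergman_inner \<alpha> h f"
  using bergman_inner_mult_left[OF assms, of c]
  by (metis bergman_inner_cnj complex_cnj_mult)

lemma bergman_inner_sum_left:
  assumes "\<And>k. k \<in> A \<Longrightarrow> B k \<in> bergman_space \<alpha>" "h \<in> bergman_space \<alpha>"
  shows "bergman_inner \<alpha> (\<lambda>z. \<Sum>k\<in>A. c k * B k z) h = (\<Sum>k\<in>A. c k * bergman_inner \<alpha> (B k) h)"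
proof (cases "finite A")
  case True
  then show ?thesis using assms(1)
  proof (induction A)
    case (insert k A)
    then have "bergman_inner \<alpha> (\<lambda>z. (\<Sum>k\<in>A. c k * B k z) + c k * B k z) h
        = (\<Sum>k\<in>A. c k * bergman_inner \<alpha> (B k) h) + c k * bergman_inner \<alpha> (B k) h"
      by (subst bergman_inner_add_mult) (auto intro!: bergman_space_sum assms(2))
    then show ?case using insert by (simp add: add.commute)
  qed simp
qed simp

lemma bergman_inner_diff_sum_left:
  assumes "f \<in> bergman_space \<alpha>" "\<And>k. k \<in> A \<Longrightarrow> B k \<in> bergman_space \<alpha>" "h \<in> bergman_space \<alpha>"
  shows "bergman_inner \<alpha> (\<lambda>z. f z - (\<Sum>k\<in>A. c k * B k z)) h
    = bergman_inner \<alpha> f h - (\<Sum>k\<in>A. c k * bergman_inner \<alpha> (B k) h)"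
  using bergman_inner_add_mult[OF assms(1) bergman_space_sum[of A B, OF assms(2)] assms(3), where c = "-1"]
    bergman_inner_sum_left[of A B \<alpha> h c, OF assms(2,3)] by simp

lemma bergman_inner_diff_sum_right:
  assumes "f \<in> bergman_space \<alpha>" "\<And>k. k \<in> A \<Longrightarrow> B k \<in> bergman_space \<alpha>" "h \<in> bergman_space \<alpha>"
  shows "bergman_inner \<alpha> h (\<lambda>z. f z - (\<Sum>k\<in>A. c k * B k z))
    = bergman_inner \<alpha> h f - (\<Sum>k\<in>A. cnj (c k) * bergman_inner \<alpha> h (B k))"
proof -
  have "cnj (bergman_inner \<alpha> (\<lambda>z. f z - (\<Sum>k\<in>A. c k * B k z)) h)
    = cnj (bergman_inner \<alpha> f h - (\<Sum>k\<in>A. c k * bergman_inner \<alpha> (B k) h))"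
    by (simp add: bergman_inner_diff_sum_left[OF assms])
  then show ?thesis by (simp add: bergman_inner_cnj)
qed

section \<open>Norms of residuals and Bessel's identity\<close>

lemma bergman_norm_nonneg: "bergman_norm \<alpha> f \<ge> 0"
  by (simp add: bergman_norm_def)

lemma bergman_norm_square: "(bergman_norm \<alpha> f)\<^sup>2 = (LINT z|weighted_area \<alpha>. (cmod (f z))\<^sup>2)"
  by (simp add: bergman_norm_def)

lemma bergman_inner_self: "bergman_inner \<alpha> f f = of_real ((bergman_norm \<alpha> f)\<^sup>2)"
proof -
  have "(\<lambda>z. f z * cnj (f z)) = (\<lambda>z. of_real ((cmod (f z))\<^sup>2))"
    by (simp only: complex_norm_square)
  then show ?thesis
    by (simp only: bergman_norm_square bergman_inner_def integral_complex_of_real)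
qed

text \<open>The cross term is kept: for orthogonal \<open>f\<close> and \<open>g\<close> this is
  Pythagoras, and for c equal to minus the inner product of \<open>f\<close> with a unit vector
  \<open>g\<close> it measures the effect of a projection.\<close>

lemma bergman_norm_add_mult_square:
  assumes "f \<in> bergman_space \<alpha>" "g \<in> bergman_space \<alpha>"
  shows "(bergman_norm \<alpha> (\<lambda>z. f z + c * g z))\<^sup>2
    = (bergman_norm \<alpha> f)\<^sup>2 + 2 * Re (cnj c * bergman_inner \<alpha> f g) + (cmod c)\<^sup>2 * (bergman_norm \<alpha> g)\<^sup>2"
proof -
  define fg where "fg = bergman_inner \<alpha> f g"
  have gf: "bergman_inner \<alpha> g f = cnj fg" by (simp add: fg_def bergman_inner_cnj)
  have V: "(\<lambda>z. f z + c * g z) \<in> bergman_space \<alpha>" by (intro bergman_space_add_mult assms)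
  have right: "bergman_inner \<alpha> h (\<lambda>z. f z + c * g z) = bergman_inner \<alpha> h f + cnj c * bergman_inner \<alpha> h g"
    if "h \<in> bergman_space \<alpha>" for h
    using bergman_inner_add_mult[OF assms that, of c]
    by (metis bergman_inner_cnj complex_cnj_add complex_cnj_mult)
  have "complex_of_real ((bergman_norm \<alpha> (\<lambda>z. f z + c * g z))\<^sup>2)
      = of_real ((bergman_norm \<alpha> f)\<^sup>2) + (cnj c * fg + cnj (cnj c * fg)) + (c * cnj c) * of_real ((bergman_norm \<alpha> g)\<^sup>2)"
    unfolding bergman_inner_self[symmetric] bergman_inner_add_mult[OF assms V] right[OF assms(1)] right[OF assms(2)] gf
    by (simp add: fg_def algebra_simps)
  also have "\<dots> = of_real ((bergman_norm \<alpha> f)\<^sup>2 + 2 * Re (cnj c * fg) + (cmod c)\<^sup>2 * (bergman_norm \<alpha> g)\<^sup>2)"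
    unfolding complex_add_cnj by (simp add: complex_norm_square del: of_real_power)
  finally show ?thesis unfolding fg_def by (simp only: of_real_eq_iff)
qed

text \<open>Members of the system may vanish identically: a normalization by the norm \<open>0\<close> yields the
  zero function.\<close>

definition orthonormal_or_zero :: "real \<Rightarrow> (nat \<Rightarrow> complex \<Rightarrow> complex) \<Rightarrow> bool" where
  "orthonormal_or_zero \<alpha> B \<longleftrightarrow> (\<forall>k. B k \<in> bergman_space \<alpha> \<and> (bergman_norm \<alpha> (B k) = 1 \<or> B k = (\<lambda>z. 0))) \<and>
     (\<forall>j k. j \<noteq> k \<longrightarrow> bergman_inner \<alpha> (B j) (B k) = 0)"

definition residual :: "real \<Rightarrow> (nat \<Rightarrow> complex \<Rightarrow> complex) \<Rightarrow> (complex \<Rightarrow> complex) \<Rightarrow> nat \<Rightarrow> complex \<Rightarrow> complex" where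
  "residual \<alpha> B f n = (\<lambda>z. f z - (\<Sum>k<n. bergman_inner \<alpha> f (B k) * B k z))"

text \<open>Lets zero members of a system pass through the same formulas as unit vectors.\<close>

lemma inner_mult_normalized:
  assumes "bergman_norm \<alpha> g = 1 \<or> g = (\<lambda>z. 0)"
  shows "bergman_inner \<alpha> f g * bergman_inner \<alpha> g g = bergman_inner \<alpha> f g"
  using assms by (auto simp: bergman_inner_self)

lemma norm_residual_step:
  assumes "f \<in> bergman_space \<alpha>" "g \<in> bergman_space \<alpha>" "bergman_norm \<alpha> g = 1 \<or> g = (\<lambda>z. 0)"
  shows "(bergman_norm \<alpha> (\<lambda>z. f z - bergman_inner \<alpha> f g * g z))\<^sup>2 = (bergman_norm \<alpha> f)\<^sup>2 - (cmod (bergman_inner \<alpha> f g))\<^sup>2"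
proof -
  define c where "c = bergman_inner \<alpha> f g"
  have "Re (cnj c * c) = (cmod c)\<^sup>2"
    by (metis Re_complex_of_real complex_norm_square mult.commute)
  moreover have "(cmod c)\<^sup>2 * (bergman_norm \<alpha> g)\<^sup>2 = (cmod c)\<^sup>2"
    using assms(3) by (auto simp: c_def)
  ultimately show ?thesis
    using bergman_norm_add_mult_square[OF assms(1,2), of "- c"] by (simp add: c_def)
qed

lemma norm_inner_normalized_le:
  assumes "f \<in> bergman_space \<alpha>" "g \<in> bergman_space \<alpha>" "bergman_norm \<alpha> g = 1 \<or> g = (\<lambda>z. 0)"
  shows "(cmod (bergman_inner \<alpha> f g))\<^sup>2 \<le> (bergman_norm \<alpha> f)\<^sup>2"
  using norm_residual_step[OF assms] by (metis diff_ge_0_iff_ge zero_le_power2)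

lemma
  assumes "orthonormal_or_zero \<alpha> B"
  shows system_in_space: "B k \<in> bergman_space \<alpha>"
    and system_normalized: "bergman_norm \<alpha> (B k) = 1 \<or> B k = (\<lambda>z. 0)"
    and system_orthogonal: "j \<noteq> k \<Longrightarrow> bergman_inner \<alpha> (B j) (B k) = 0"
  using assms unfolding orthonormal_or_zero_def by auto

context
  fixes \<alpha> :: real and B :: "nat \<Rightarrow> complex \<Rightarrow> complex" and f :: "complex \<Rightarrow> complex"
  assumes B: "orthonormal_or_zero \<alpha> B" and f: "f \<in> bergman_space \<alpha>"
begin

lemma residual_in_space: "residual \<alpha> B f n \<in> bergman_space \<alpha>"
  unfolding residual_def by (intro bergman_space_diff_sum f system_in_space[OF B])

text \<open>By orthogonality, subtracting the first \<open>n\<close> terms cancels exactly the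
  coefficients below \<open>n\<close>. In particular the residual and \<open>f\<close> have the same
  coefficient against \<open>B n\<close>.\<close>

lemma inner_residual: "bergman_inner \<alpha> (residual \<alpha> B f n) (B j) = (if j < n then 0 else bergman_inner \<alpha> f (B j))"
proof -
  have "bergman_inner \<alpha> (residual \<alpha> B f n) (B j)
      = bergman_inner \<alpha> f (B j) - (\<Sum>k<n. bergman_inner \<alpha> f (B k) * bergman_inner \<alpha> (B k) (B j))"
    unfolding residual_def by (intro bergman_inner_diff_sum_left f system_in_space[OF B])
  also have "(\<Sum>k<n. bergman_inner \<alpha> f (B k) * bergman_inner \<alpha> (B k) (B j))
      = (\<Sum>k<n. if k = j then bergman_inner \<alpha> f (B j) else 0)"
    using system_orthogonal[OF B] inner_mult_normalized[OF system_normalized[OF B]]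
    by (intro sum.cong) auto
  finally show ?thesis by (simp add: sum.delta)
qed

lemma norm_residual: "(bergman_norm \<alpha> (residual \<alpha> B f n))\<^sup>2 = (bergman_norm \<alpha> f)\<^sup>2 - (\<Sum>k<n. (cmod (bergman_inner \<alpha> f (B k)))\<^sup>2)"
proof (induction n)
  case 0
  then show ?case by (simp add: residual_def)
next
  case (Suc n)
  \<comment> \<open>Since the next coefficient may be computed from the residual itself, passing
    from \<open>n\<close> to \<open>Suc n\<close> is one projection step, and the norm identity
    telescopes.\<close>
  have "residual \<alpha> B f (Suc n) = (\<lambda>z. residual \<alpha> B f n z - bergman_inner \<alpha> (residual \<alpha> B f n) (B n) * B n z)"
    unfolding inner_residual by (simp add: residual_def algebra_simps)
  then have "(bergman_norm \<alpha> (residual \<alpha> B f (Suc n)))\<^sup>2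
      = (bergman_norm \<alpha> (residual \<alpha> B f n))\<^sup>2 - (cmod (bergman_inner \<alpha> (residual \<alpha> B f n) (B n)))\<^sup>2"
    using norm_residual_step[OF residual_in_space system_in_space[OF B] system_normalized[OF B]] by simp
  then show ?case by (simp add: Suc inner_residual)
qed

text \<open>The difference of two residuals is a finite block of the expansion, whose norm follows
  from Pythagoras. With summable squared coefficients this gives the Cauchy property.\<close>

lemma norm_residual_diff:
  assumes "m \<le> n"
  shows "(bergman_norm \<alpha> (\<lambda>z. residual \<alpha> B f m z - residual \<alpha> B f n z))\<^sup>2 = (\<Sum>k=m..<n. (cmod (bergman_inner \<alpha> f (B k)))\<^sup>2)"
proof -
  define c where "c k = bergman_inner \<alpha> f (B k)" for k
  have "(\<lambda>z. residual \<alpha> B f m z - residual \<alpha> B f n z) = (\<lambda>z. \<Sum>k=m..<n. c k * B k z)"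
  proof
    fix z
    have "(\<Sum>k<n. c k * B k z) = (\<Sum>k<m. c k * B k z) + (\<Sum>k=m..<n. c k * B k z)"
      using sum.atLeastLessThan_concat[of 0 m n "\<lambda>k. c k * B k z"] assms by (simp add: atLeast0LessThan)
    then show "residual \<alpha> B f m z - residual \<alpha> B f n z = (\<Sum>k=m..<n. c k * B k z)"
      by (simp add: residual_def c_def)
  qed
  moreover have "(bergman_norm \<alpha> (\<lambda>z. \<Sum>k\<in>A. c k * B k z))\<^sup>2 = (\<Sum>k\<in>A. (cmod (c k))\<^sup>2)" if "finite A" for A
    using that
  proof (induction A)
    case empty
    then show ?case by (simp add: bergman_norm_def)
  next
    case (insert k A)
    have "bergman_inner \<alpha> (\<lambda>z. \<Sum>k\<in>A. c k * B k z) (B k) = (\<Sum>j\<in>A. c j * bergman_inner \<alpha> (B j) (B k))"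
      by (intro bergman_inner_sum_left system_in_space[OF B])
    also have "\<dots> = 0" using insert by (intro sum.neutral) (auto intro: system_orthogonal[OF B])
    finally have "(bergman_norm \<alpha> (\<lambda>z. (\<Sum>j\<in>A. c j * B j z) + c k * B k z))\<^sup>2
        = (\<Sum>j\<in>A. (cmod (c j))\<^sup>2) + (cmod (c k))\<^sup>2 * (bergman_norm \<alpha> (B k))\<^sup>2"
      using bergman_norm_add_mult_square[OF bergman_space_sum[of A B \<alpha> c] system_in_space[OF B, of k], of "c k"] insert
      by (simp add: system_in_space[OF B])
    \<comment> \<open>If \<open>B k\<close> is the zero function, its coefficient is 0 too, so the
      missing normalization does no harm.\<close>
    also have "(cmod (c k))\<^sup>2 * (bergman_norm \<alpha> (B k))\<^sup>2 = (cmod (c k))\<^sup>2"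
      using system_normalized[OF B, of k] by (auto simp: c_def)
    finally show ?case using insert by (simp add: add.commute)
  qed
  ultimately show ?thesis by (simp add: c_def)
qed

end

section \<open>Generalized kernels and their orthonormalization\<close>

text \<open>The real derivative of F(cnj v) is h -> F' cnj h, and (F' + i F' cnj i) / 2 = F'. The
  formula for \<open>g\<close> is asked for only on an open set, so that it can be iterated with
  closed forms valid in the disc.\<close>

lemma wirtinger_cnj_of_holomorphic_cnj:
  assumes S: "open S" "w \<in> S"
    and eq: "\<And>v. v \<in> S \<Longrightarrow> g v = F (cnj v)"
    and der: "(F has_field_derivative F') (at (cnj w))"
  shows "wirtinger_cnj g w = F'"
proof -
  have "((\<lambda>v. F (cnj v)) has_derivative (\<lambda>h. F' * cnj h)) (at w)"
    using der unfolding has_field_derivative_def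
    by (intro has_derivative_compose[OF has_derivative_cnj[OF has_derivative_ident]])
  then have "(g has_derivative (\<lambda>h. F' * cnj h)) (at w)"
    using S eq by (auto intro: has_derivative_transform_within_open)
  from frechet_derivative_at[OF this, symmetric] show ?thesis
    by (simp add: wirtinger_cnj_def mult.left_commute[of \<i>])
qed

text \<open>Each derivative brings down the exponent - (2 + \<alpha>) - m and the inner factor -z.
  Their product is (2 + \<alpha> + m) z, and these factors build the Pochhammer symbol.\<close>

lemma wirtinger_cnj_funpow_bergman_kernel:
  assumes z: "cmod z \<le> 1" and w: "w \<in> unit_disc"
  shows "(wirtinger_cnj ^^ m) (\<lambda>w. bergman_kernel \<alpha> w z) w
    = of_real (pochhammer (2 + \<alpha>) m) * z ^ m * (1 - cnj w * z) powr (of_real (- (2 + \<alpha>) - real m))"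
  using w
proof (induction m arbitrary: w)
  case 0
  have "bergman_kernel \<alpha> w z = (1 - cnj w * z) powr - of_real (2 + \<alpha>)"
    unfolding bergman_kernel_def by (rule powr_minus_divide[symmetric])
  then show ?case by simp
next
  case (Suc m)
  define e where "e = - (2 + \<alpha>) - real m"
  have nz: "1 - cnj w * z \<notin> \<real>\<^sub>\<le>\<^sub>0" using one_minus_cnj_mult_notin_nonpos[OF Suc.prems z] .
  define F where "F u = of_real (pochhammer (2 + \<alpha>) m) * z ^ m * (1 - u * z) powr (of_real e)" for u
  have "((\<lambda>u. (1 - u * z) powr (of_real e)) has_field_derivative
      (of_real e * (1 - cnj w * z) powr (of_real e - 1) * (0 - 1 * z))) (at (cnj w))"
    using nz by (intro has_field_derivative_powr[THEN DERIV_chain2]) (auto intro!: derivative_eq_intros)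
  then have "(F has_field_derivative of_real (pochhammer (2 + \<alpha>) m) * z ^ m *
      (of_real e * (1 - cnj w * z) powr (of_real e - 1) * (0 - 1 * z))) (at (cnj w))"
    unfolding F_def by (rule DERIV_cmult)
  then have "wirtinger_cnj ((wirtinger_cnj ^^ m) (\<lambda>w. bergman_kernel \<alpha> w z)) w
      = of_real (pochhammer (2 + \<alpha>) m) * z ^ m *
      (of_real e * (1 - cnj w * z) powr (of_real e - 1) * (0 - 1 * z))"
    using Suc by (intro wirtinger_cnj_of_holomorphic_cnj[of unit_disc w _ F]) (auto simp: F_def e_def)
  also have "\<dots> = of_real (pochhammer (2 + \<alpha>) (Suc m)) * z ^ Suc m * (1 - cnj w * z) powr (of_real e - 1)"
    by (simp add: pochhammer_Suc e_def algebra_simps)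
  also have "complex_of_real e - 1 = of_real (- (2 + \<alpha>) - real (Suc m))"
    by (simp add: e_def)
  finally show ?case by simp
qed

lemma bergman_space_bounded:
  assumes \<alpha>: "-1 < \<alpha>" and g: "g holomorphic_on unit_disc"
    and bound: "\<And>z. z \<in> unit_disc \<Longrightarrow> cmod (g z) \<le> C"
  shows "g \<in> bergman_space \<alpha>"
proof -
  interpret finite_measure "weighted_area \<alpha>" by (rule finite_weighted_area[OF \<alpha>])
  have "integrable (weighted_area \<alpha>) (\<lambda>z. (cmod (g z))\<^sup>2)"
  proof (rule integrable_const_bound)
    show "AE z in weighted_area \<alpha>. norm ((cmod (g z))\<^sup>2) \<le> C\<^sup>2"
      using bound by (intro AE_I2) (auto intro: power_mono)
    show "(\<lambda>z. (cmod (g z))\<^sup>2) \<in> borel_measurable (weighted_area \<alpha>)"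
      by (intro continuous_on_disc_measurable continuous_intros holomorphic_on_imp_continuous_on g)
  qed
  with g show ?thesis by (simp add: bergman_space_def)
qed

text \<open>As \<open>a j\<close> is an interior point, the closed form is continuous on the closed
  disc, hence bounded by compactness, and the measure is finite.\<close>

lemma gen_kernel_in_bergman_space:
  assumes \<alpha>: "-1 < \<alpha>" and a: "a j \<in> unit_disc"
  shows "gen_kernel \<alpha> a j \<in> bergman_space \<alpha>"
proof -
  define m where "m = occurrence a j - 1"
  define F where "F z = of_real (pochhammer (2 + \<alpha>) m) * z ^ m * (1 - cnj (a j) * z) powr (of_real (- (2 + \<alpha>) - real m))" for z
  have eq: "gen_kernel \<alpha> a j z = F z" if "cmod z \<le> 1" for z
    unfolding gen_kernel_def m_def[symmetric] F_def by (rule wirtinger_cnj_funpow_bergman_kernel[OF that a])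
  have hol: "F holomorphic_on S" if "S \<subseteq> cball 0 1" for S
    unfolding F_def using that one_minus_cnj_mult_notin_nonpos[OF a]
    by (intro holomorphic_intros) auto
  have "compact (F ` cball 0 1)"
    by (intro compact_continuous_image holomorphic_on_imp_continuous_on hol) auto
  then obtain C where C: "\<And>z. z \<in> cball 0 1 \<Longrightarrow> cmod (F z) \<le> C"
    using compact_imp_bounded by (force simp: bounded_iff)
  show ?thesis
  proof (rule bergman_space_bounded[OF \<alpha>])
    have "F holomorphic_on unit_disc" by (rule hol) auto
    then show "gen_kernel \<alpha> a j holomorphic_on unit_disc"
      using eq by (subst holomorphic_cong[OF refl, of _ _ F]) auto
    show "cmod (gen_kernel \<alpha> a j z) \<le> C" if "z \<in> unit_disc" for z
      using that C[of z] eq[of z] by auto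
  qed
qed

section \<open>Gram-Schmidt orthonormalization\<close>

text \<open>Reads the unnormalized vector as the residual of \<open>v n\<close>, so that the facts
  on residuals apply to Gram-Schmidt.\<close>

lemma gram_schmidt_eq_residual:
  "gram_schmidt \<alpha> v n = (\<lambda>z. residual \<alpha> (gram_schmidt \<alpha> v) (v n) n z
     / complex_of_real (bergman_norm \<alpha> (residual \<alpha> (gram_schmidt \<alpha> v) (v n) n)))"
  unfolding residual_def by (subst gram_schmidt.simps) (simp add: Let_def)

lemma gram_schmidt_cong: "(\<And>k. k \<le> n \<Longrightarrow> v k = v' k) \<Longrightarrow> gram_schmidt \<alpha> v n = gram_schmidt \<alpha> v' n"
proof (induction n rule: less_induct)
  case (less n)
  have "residual \<alpha> (gram_schmidt \<alpha> v) (v n) n = residual \<alpha> (gram_schmidt \<alpha> v') (v' n) n"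
    unfolding residual_def using less by (intro ext) simp
  then show ?case
    by (subst (1 2) gram_schmidt_eq_residual) simp
qed

text \<open>Strong induction on the index. A residual of norm 0 is divided by 0 and becomes the zero
  function, so linearly dependent families are covered as well.\<close>

lemma orthonormal_or_zero_gram_schmidt:
  assumes v: "\<And>n. v n \<in> bergman_space \<alpha>"
  shows "orthonormal_or_zero \<alpha> (gram_schmidt \<alpha> v)"
proof -
  define B where "B = gram_schmidt \<alpha> v"
  have *: "B n \<in> bergman_space \<alpha> \<and> (bergman_norm \<alpha> (B n) = 1 \<or> B n = (\<lambda>z. 0)) \<and>
     (\<forall>j<n. bergman_inner \<alpha> (B n) (B j) = 0)" for n
  proof (induction n rule: less_induct)
    case (less n)
    define u where "u = residual \<alpha> B (v n) n"
    define r where "r = bergman_norm \<alpha> u"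
    have Bn: "B n = (\<lambda>z. inverse (of_real r) * u z)"
      unfolding B_def u_def r_def by (subst gram_schmidt_eq_residual) (simp add: divide_inverse mult.commute)
    have u: "u \<in> bergman_space \<alpha>"
      unfolding u_def residual_def using less by (intro bergman_space_diff_sum v) auto
    then have V: "B n \<in> bergman_space \<alpha>"
      unfolding Bn by (rule bergman_space_mult)
    have "(bergman_norm \<alpha> (B n))\<^sup>2 = (inverse r)\<^sup>2 * r\<^sup>2"
      using bergman_norm_add_mult_square[OF bergman_space_zero u, of "inverse (of_real r)"]
      by (simp add: Bn r_def norm_inverse bergman_norm_nonneg bergman_norm_def[of _ "\<lambda>z. 0"])
    then have norm: "bergman_norm \<alpha> (B n) = 1 \<or> B n = (\<lambda>z. 0)"
      using bergman_norm_nonneg[of \<alpha> "B n"]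
      by (cases "r = 0") (auto simp: Bn power2_eq_1_iff field_simps)
    have orth: "bergman_inner \<alpha> (B n) (B j) = 0" if j: "j < n" for j
    proof -
      have "bergman_inner \<alpha> u (B j) = bergman_inner \<alpha> (v n) (B j)
          - (\<Sum>k<n. bergman_inner \<alpha> (v n) (B k) * bergman_inner \<alpha> (B k) (B j))"
        unfolding u_def residual_def using less j by (intro bergman_inner_diff_sum_left v) auto
      also have "(\<Sum>k<n. bergman_inner \<alpha> (v n) (B k) * bergman_inner \<alpha> (B k) (B j))
          = (\<Sum>k<n. if k = j then bergman_inner \<alpha> (v n) (B j) else 0)"
      proof (intro sum.cong refl)
        fix k assume k: "k \<in> {..<n}"
        \<comment> \<open>The induction hypothesis has the larger index on the left; conjugate
          symmetry supplies the other order.\<close>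
        have "bergman_inner \<alpha> (B k) (B j) = 0" if "k \<noteq> j"
        proof (cases "k < j")
          case True
          then have "bergman_inner \<alpha> (B j) (B k) = 0" using less j by blast
          then show ?thesis by (metis bergman_inner_cnj complex_cnj_zero)
        qed (use less k that in auto)
        then show "bergman_inner \<alpha> (v n) (B k) * bergman_inner \<alpha> (B k) (B j)
            = (if k = j then bergman_inner \<alpha> (v n) (B j) else 0)"
          using inner_mult_normalized[of \<alpha> "B j" "v n"] less j by auto
      qed
      also have "bergman_inner \<alpha> (v n) (B j) - \<dots> = 0" using j by simp
      finally show ?thesis
        unfolding Bn using bergman_inner_mult_left[OF u, of "B j" "inverse (of_real r)"] less j
        by (simp add: Bn)
    qed
    show ?case using V norm orth by blast
  qed
  have "bergman_inner \<alpha> (B j) (B k) = 0" if "j \<noteq> k" for j k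
  proof (cases "k < j")
    case False
    with that have "bergman_inner \<alpha> (B k) (B j) = 0" using * by simp
    then show ?thesis by (metis bergman_inner_cnj complex_cnj_zero)
  qed (use * in blast)
  then show ?thesis using * unfolding orthonormal_or_zero_def B_def by blast
qed

lemma orthonormal_or_zero_kernel_onb:
  assumes "-1 < \<alpha>" "\<And>n. a n \<in> unit_disc"
  shows "orthonormal_or_zero \<alpha> (kernel_onb \<alpha> a)"
  using orthonormal_or_zero_gram_schmidt[OF gen_kernel_in_bergman_space[OF assms]]
  unfolding kernel_onb_def[abs_def] by simp

lemma gen_kernel_fun_upd:
  assumes "k < n" shows "gen_kernel \<alpha> (a(n := b)) k = gen_kernel \<alpha> a k"
proof -
  have "{i. i \<le> k \<and> (a(n := b)) i = (a(n := b)) k} = {i. i \<le> k \<and> a i = a k}"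
    using assms by auto
  then have "occurrence (a(n := b)) k = occurrence a k"
    unfolding occurrence_def by simp
  then show ?thesis using assms by (simp add: gen_kernel_def[abs_def])
qed

lemma kernel_onb_fun_upd:
  "k < n \<Longrightarrow> kernel_onb \<alpha> (a(n := b)) k = kernel_onb \<alpha> a k"
  unfolding kernel_onb_def by (intro gram_schmidt_cong gen_kernel_fun_upd) simp

text \<open>A point that differs from all earlier ones occurs once, so no derivative is taken and
  the plain reproducing kernel remains.\<close>

lemma gen_kernel_fresh:
  assumes "\<And>i. i < n \<Longrightarrow> a i \<noteq> b"
  shows "gen_kernel \<alpha> (a(n := b)) n = bergman_kernel \<alpha> b"
proof -
  have "{i. i \<le> n \<and> (a(n := b)) i = (a(n := b)) n} = {n}"
    using assms by (auto simp: le_less)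
  then have "occurrence (a(n := b)) n = 1"
    unfolding occurrence_def by simp
  then show ?thesis by (simp add: gen_kernel_def[abs_def])
qed

text \<open>A function of norm 0 vanishes almost everywhere. This handles the degenerate case of
  Gram-Schmidt in the next estimate.\<close>

lemma bergman_inner_norm_zero:
  assumes "f \<in> bergman_space \<alpha>" "g \<in> bergman_space \<alpha>" "bergman_norm \<alpha> g = 0"
  shows "bergman_inner \<alpha> f g = 0"
proof -
  have "(LINT z|weighted_area \<alpha>. (cmod (g z))\<^sup>2) = 0"
    using assms(3) bergman_norm_square[of \<alpha> g] by simp
  then have "AE z in weighted_area \<alpha>. (cmod (g z))\<^sup>2 = 0"
    using assms(2) by (subst (asm) integral_nonneg_eq_0_iff_AE) (auto intro: bergman_space_integrable)
  then have "AE z in weighted_area \<alpha>. f z * cnj (g z) = 0"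
    by eventually_elim simp
  then show ?thesis
    unfolding bergman_inner_def by (rule integral_eq_zero_AE)
qed

section \<open>Pointwise estimate of the residuals and maximality\<close>

text \<open>The residual \<open>h\<close> is orthogonal to the first \<open>n\<close> members, so
  its inner product with the kernel at \<open>b\<close> equals that with \<open>u\<close>, the
  kernel's own residual. Now \<open>u\<close> is \<open>r\<close> times the new member up to a null
  case, \<open>r\<close> is at most the norm of the kernel, and \<open>h\<close> has the same
  coefficient as \<open>f\<close> against the new member. The reproducing property turns this into a
  bound for \<open>h b\<close>.\<close>

lemma norm_residual_value_le:
  fixes a :: "nat \<Rightarrow> complex"
  assumes \<alpha>: "-1 < \<alpha>" and f: "f \<in> bergman_space \<alpha>" and a: "\<And>n. a n \<in> unit_disc"
    and b: "b \<in> unit_disc" "b \<notin> range a"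
  shows "measure (weighted_area \<alpha>) unit_disc * cmod (residual \<alpha> (kernel_onb \<alpha> a) f n b)
    \<le> bergman_norm \<alpha> (bergman_kernel \<alpha> b) * cmod (bergman_inner \<alpha> f (kernel_onb \<alpha> (a(n := b)) n))"
proof -
  define B where "B = kernel_onb \<alpha> (a(n := b))"
  define h where "h = residual \<alpha> B f n"
  define u where "u = residual \<alpha> B (bergman_kernel \<alpha> b) n"
  define r where "r = bergman_norm \<alpha> u"
  have onb: "orthonormal_or_zero \<alpha> B"
    unfolding B_def using a b by (intro orthonormal_or_zero_kernel_onb \<alpha>) auto
  note B_V = system_in_space[OF onb]
  \<comment> \<open>The residual uses only members below \<open>n\<close>, which the replacement of
    the n-th point leaves unchanged.\<close>
  have h_eq: "residual \<alpha> (kernel_onb \<alpha> a) f n = h"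
    unfolding h_def residual_def B_def by (simp add: kernel_onb_fun_upd)
  have fresh: "gen_kernel \<alpha> (a(n := b)) n = bergman_kernel \<alpha> b"
    using b by (intro gen_kernel_fresh) auto
  have k: "bergman_kernel \<alpha> b \<in> bergman_space \<alpha>"
    using gen_kernel_in_bergman_space[OF \<alpha>, of "a(n := b)" n] fresh b by simp
  have h: "h \<in> bergman_space \<alpha>" unfolding h_def by (rule residual_in_space[OF onb f])
  have u: "u \<in> bergman_space \<alpha>" unfolding u_def by (rule residual_in_space[OF onb k])
  have Bn: "B n = (\<lambda>z. u z / of_real r)"
    unfolding r_def u_def B_def kernel_onb_def[abs_def] fresh[symmetric] by (rule gram_schmidt_eq_residual)
  have "bergman_inner \<alpha> h u = bergman_inner \<alpha> h (bergman_kernel \<alpha> b) -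
      (\<Sum>k<n. cnj (bergman_inner \<alpha> (bergman_kernel \<alpha> b) (B k)) * bergman_inner \<alpha> h (B k))"
    unfolding u_def residual_def by (intro bergman_inner_diff_sum_right k B_V h)
  also have "(\<Sum>k<n. cnj (bergman_inner \<alpha> (bergman_kernel \<alpha> b) (B k)) * bergman_inner \<alpha> h (B k)) = 0"
    by (intro sum.neutral) (simp add: h_def inner_residual[OF onb f])
  finally have 1: "bergman_inner \<alpha> h (bergman_kernel \<alpha> b) = bergman_inner \<alpha> h u" by simp
  have 2: "bergman_inner \<alpha> h u = of_real r * bergman_inner \<alpha> f (B n)"
  proof (cases "r = 0")
    case True
    then show ?thesis using bergman_inner_norm_zero[OF h u] by (simp add: r_def)
  next
    case False
    then have "u = (\<lambda>z. of_real r * B n z)" by (simp add: Bn)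
    then have "bergman_inner \<alpha> h u = of_real r * bergman_inner \<alpha> h (B n)"
      using bergman_inner_mult_right[OF B_V h, of "of_real r" n] by simp
    then show ?thesis by (simp add: h_def inner_residual[OF onb f])
  qed
  have "r\<^sup>2 \<le> (bergman_norm \<alpha> (bergman_kernel \<alpha> b))\<^sup>2"
    unfolding r_def u_def norm_residual[OF onb k] by (simp add: sum_nonneg)
  then have r: "0 \<le> r" "r \<le> bergman_norm \<alpha> (bergman_kernel \<alpha> b)"
    by (auto simp: r_def bergman_norm_nonneg intro: power2_le_imp_le)
  have "bergman_inner \<alpha> h (bergman_kernel \<alpha> b) = of_real (measure (weighted_area \<alpha>) unit_disc) * h b"
    by (intro bergman_reproducing b \<alpha> bergman_space_holomorphic[OF h] bergman_space_integrable_mult h k)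
  with 1 2 have "of_real (measure (weighted_area \<alpha>) unit_disc) * h b = of_real r * bergman_inner \<alpha> f (B n)"
    by simp
  then have "measure (weighted_area \<alpha>) unit_disc * cmod (h b) = r * cmod (bergman_inner \<alpha> f (B n))"
    using r by (metis norm_mult norm_of_real abs_of_nonneg measure_nonneg)
  also have "\<dots> \<le> bergman_norm \<alpha> (bergman_kernel \<alpha> b) * cmod (bergman_inner \<alpha> f (B n))"
    using r by (intro mult_right_mono) auto
  finally show ?thesis by (simp add: h_eq B_def)
qed

lemma AE_weighted_area_notin_countable:
  assumes "countable A" shows "AE z in weighted_area \<alpha>. z \<notin> A"
proof -
  have "AE z in disc_lborel. z \<notin> A"
    using AE_not_in[OF countable_imp_null_set_lborel[OF assms]] by (auto simp: AE_restrict_space_iff elim: eventually_mono)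
  then show ?thesis
    unfolding weighted_area_eq by (subst AE_density) (auto intro: measurable_restrict_space1)
qed

text \<open>A real supremum dominates the members of a family only if the family is bounded above;
  Bessel's inequality supplies the bound by the squared norm of \<open>f\<close>, uniformly in the
  chosen point.\<close>

lemma norm_selection_le:
  assumes \<alpha>: "-1 < \<alpha>" and f: "f \<in> bergman_space \<alpha>"
    and sel: "consecutive_maximal_selections \<alpha> f a" and b: "b \<in> unit_disc"
  shows "cmod (bergman_inner \<alpha> f (kernel_onb \<alpha> (a(n := b)) n)) \<le> cmod (bergman_inner \<alpha> f (kernel_onb \<alpha> a n))"
proof (rule power2_le_imp_le)
  define S where "S c = (cmod (bergman_inner \<alpha> f (kernel_onb \<alpha> (a(n := c)) n)))\<^sup>2" for c
  have a: "a k \<in> unit_disc" for k using sel by (simp add: consecutive_maximal_selections_def)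
  have "S c \<le> (bergman_norm \<alpha> f)\<^sup>2" if "c \<in> unit_disc" for c
  proof -
    have onb: "orthonormal_or_zero \<alpha> (kernel_onb \<alpha> (a(n := c)))"
      using a that by (intro orthonormal_or_zero_kernel_onb \<alpha>) auto
    show ?thesis unfolding S_def
      by (intro norm_inner_normalized_le f system_in_space[OF onb] system_normalized[OF onb])
  qed
  then have "bdd_above (S ` unit_disc)" by (auto intro!: bdd_aboveI)
  then have "S b \<le> (SUP c\<in>unit_disc. S c)" using b by (rule cSUP_upper[rotated])
  also have "\<dots> = (cmod (bergman_inner \<alpha> f (kernel_onb \<alpha> a n)))\<^sup>2"
    using sel unfolding consecutive_maximal_selections_def S_def by simp
  finally show "(cmod (bergman_inner \<alpha> f (kernel_onb \<alpha> (a(n := b)) n)))\<^sup>2 \<le> (cmod (bergman_inner \<alpha> f (kernel_onb \<alpha> a n)))\<^sup>2"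
    by (simp add: S_def)
qed simp

lemma summable_coefficients:
  assumes onb: "orthonormal_or_zero \<alpha> B" and f: "f \<in> bergman_space \<alpha>"
  shows "summable (\<lambda>k. (cmod (bergman_inner \<alpha> f (B k)))\<^sup>2)"
proof (rule bounded_imp_summable)
  show "(\<Sum>k\<le>n. (cmod (bergman_inner \<alpha> f (B k)))\<^sup>2) \<le> (bergman_norm \<alpha> f)\<^sup>2" for n
    using norm_residual[OF onb f, of "Suc n"] zero_le_power2[of "bergman_norm \<alpha> (residual \<alpha> B f (Suc n))"]
    unfolding lessThan_Suc_atMost by linarith
qed simp

theorem theorem8p2:
  fixes \<alpha> :: real and f :: "complex \<Rightarrow> complex" and a :: "nat \<Rightarrow> complex"
  assumes "- 1 < \<alpha>"
    and "f \<in> bergman_space \<alpha>"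
    and "consecutive_maximal_selections \<alpha> f a"
  shows "(\<lambda>N. bergman_norm \<alpha>
            (\<lambda>z. f z - (\<Sum>k<N. bergman_inner \<alpha> f (kernel_onb \<alpha> a k) * kernel_onb \<alpha> a k z)))
         \<longlonglongrightarrow> 0"
proof -
  define B where "B = kernel_onb \<alpha> a"
  define R where "R = residual \<alpha> B f"
  define c where "c k = (cmod (bergman_inner \<alpha> f (B k)))\<^sup>2" for k
  \<comment> \<open>\<open>T n\<close> is the tail of the series of squared coefficients. It bounds
    the squared distance from \<open>R n\<close> to every later residual.\<close>
  define T where "T n = suminf c - (\<Sum>k<n. c k)" for n
  have a: "a k \<in> unit_disc" for k
    using assms(3) by (simp add: consecutive_maximal_selections_def)
  have onb: "orthonormal_or_zero \<alpha> B"
    unfolding B_def by (intro orthonormal_or_zero_kernel_onb assms(1) a)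
  have R_V: "R n \<in> bergman_space \<alpha>" for n
    unfolding R_def by (rule residual_in_space[OF onb assms(2)])
  have R_meas [measurable]: "R n \<in> borel_measurable (weighted_area \<alpha>)" for n
    by (rule bergman_space_measurable[OF R_V])
  have c: "summable c"
    unfolding c_def[abs_def] by (rule summable_coefficients[OF onb assms(2)])
  have "(\<lambda>n. sqrt (c n)) \<longlonglongrightarrow> sqrt 0"
    by (intro tendsto_real_sqrt summable_LIMSEQ_zero c)
  then have coeff: "(\<lambda>n. cmod (bergman_inner \<alpha> f (B n))) \<longlonglongrightarrow> 0"
    by (simp add: c_def)
  \<comment> \<open>The factor \<kappa> / \<mu> depends on \<open>b\<close> but not on
    \<open>n\<close>, so the decay of the coefficients suffices.\<close>
  have pointwise: "(\<lambda>n. R n b) \<longlonglongrightarrow> 0" if b: "b \<in> unit_disc" "b \<notin> range a" for b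
  proof -
    define \<mu> where "\<mu> = measure (weighted_area \<alpha>) unit_disc"
    define \<kappa> where "\<kappa> = bergman_norm \<alpha> (bergman_kernel \<alpha> b)"
    have \<mu>: "\<mu> > 0" unfolding \<mu>_def by (rule measure_weighted_area_pos[OF assms(1)])
    have "\<mu> * cmod (R n b) \<le> \<kappa> * cmod (bergman_inner \<alpha> f (B n))" for n
    proof -
      have "\<mu> * cmod (R n b) \<le> \<kappa> * cmod (bergman_inner \<alpha> f (kernel_onb \<alpha> (a(n := b)) n))"
        unfolding \<mu>_def \<kappa>_def R_def B_def by (rule norm_residual_value_le[OF assms(1,2) a b])
      also have "\<dots> \<le> \<kappa> * cmod (bergman_inner \<alpha> f (B n))"
        unfolding B_def \<kappa>_def
        by (intro mult_left_mono norm_selection_le[OF assms b(1)] bergman_norm_nonneg)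
      finally show ?thesis .
    qed
    then have le: "norm (R n b) \<le> \<kappa> * cmod (bergman_inner \<alpha> f (B n)) / \<mu>" for n
      using \<mu> by (simp add: pos_le_divide_eq mult.commute)
    have "(\<lambda>n. \<kappa> * cmod (bergman_inner \<alpha> f (B n)) / \<mu>) \<longlonglongrightarrow> \<kappa> * 0 / \<mu>"
      using \<mu> by (intro tendsto_intros coeff) auto
    then have "(\<lambda>n. \<kappa> * cmod (bergman_inner \<alpha> f (B n)) / \<mu>) \<longlonglongrightarrow> 0" by simp
    then show ?thesis
      by (rule Lim_null_comparison[OF always_eventually, rotated]) (use le in blast)
  qed
  \<comment> \<open>Fatou's lemma: as m grows, \<open>D m\<close> tends almost everywhere to the
    squared modulus of \<open>R n\<close>, while its integral is at most \<open>T n\<close> once m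
    \<ge> n.\<close>
  have bound: "(bergman_norm \<alpha> (R n))\<^sup>2 \<le> T n" for n
  proof -
    define D where "D m z = ennreal ((cmod (R n z - R m z))\<^sup>2)" for m z
    have diff_V: "(\<lambda>z. R n z - R m z) \<in> bergman_space \<alpha>" for m
      using bergman_space_add_mult[OF R_V R_V, of n "-1" m] by simp
    have T: "0 \<le> T n"
      unfolding T_def using sum_le_suminf[OF c, of "{..<n}"] by (simp add: c_def)
    have D_le: "integral\<^sup>N (weighted_area \<alpha>) (D m) \<le> ennreal (T n)" if "n \<le> m" for m
    proof -
      have "integral\<^sup>N (weighted_area \<alpha>) (D m) = ennreal ((bergman_norm \<alpha> (\<lambda>z. R n z - R m z))\<^sup>2)"
        unfolding D_def bergman_norm_square
        by (intro nn_integral_eq_integral bergman_space_integrable diff_V) auto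
      also have "(bergman_norm \<alpha> (\<lambda>z. R n z - R m z))\<^sup>2 = (\<Sum>k=n..<m. c k)"
        unfolding R_def c_def by (rule norm_residual_diff[OF onb assms(2) that])
      also have "\<dots> \<le> T n"
      proof -
        have "(\<Sum>k<n. c k) + (\<Sum>k=n..<m. c k) = (\<Sum>k<m. c k)"
          using sum.atLeastLessThan_concat[of 0 n m c] that by (simp add: atLeast0LessThan)
        also have "\<dots> \<le> suminf c"
          by (intro sum_le_suminf c) (auto simp: c_def)
        finally show ?thesis by (simp add: T_def)
      qed
      finally show ?thesis by (simp add: ennreal_leI)
    qed
    have "ennreal ((bergman_norm \<alpha> (R n))\<^sup>2) = (\<integral>\<^sup>+z. ennreal ((cmod (R n z))\<^sup>2) \<partial>weighted_area \<alpha>)"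
      unfolding bergman_norm_square
      by (intro nn_integral_eq_integral[symmetric] bergman_space_integrable R_V) auto
    also have "\<dots> = (\<integral>\<^sup>+z. liminf (\<lambda>m. D m z) \<partial>weighted_area \<alpha>)"
    proof (rule nn_integral_cong_AE)
      \<comment> \<open>The pointwise limit is known off the selected points, which form a countable
        and hence null set.\<close>
      have "AE z in weighted_area \<alpha>. z \<notin> range a"
        by (intro AE_weighted_area_notin_countable) auto
      then show "AE z in weighted_area \<alpha>. ennreal ((cmod (R n z))\<^sup>2) = liminf (\<lambda>m. D m z)"
      proof (rule AE_mp, intro AE_I2 impI)
        fix z assume "z \<in> space (weighted_area \<alpha>)" "z \<notin> range a"
        then have "(\<lambda>m. R m z) \<longlonglongrightarrow> 0" by (intro pointwise) simp_all
        then have "(\<lambda>m. D m z) \<longlonglongrightarrow> ennreal ((cmod (R n z - 0))\<^sup>2)"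
          unfolding D_def by (intro tendsto_intros tendsto_ennrealI)
        then show "ennreal ((cmod (R n z))\<^sup>2) = liminf (\<lambda>m. D m z)"
          by (simp add: lim_imp_Liminf)
      qed
    qed
    also have "\<dots> \<le> liminf (\<lambda>m. integral\<^sup>N (weighted_area \<alpha>) (D m))"
      unfolding D_def by (intro nn_integral_liminf) measurable
    \<comment> \<open>An upper bound valid for all large m passes directly to the upper limit, and
      thereby to the lower one.\<close>
    also have "\<dots> \<le> limsup (\<lambda>m. integral\<^sup>N (weighted_area \<alpha>) (D m))"
      by (rule Liminf_le_Limsup) simp
    also have "\<dots> \<le> ennreal (T n)"
      by (rule Limsup_bounded, rule eventually_sequentiallyI) (rule D_le)
    finally show ?thesis using T by (simp add: ennreal_le_iff)
  qed
  have "T \<longlonglongrightarrow> suminf c - suminf c"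
    unfolding T_def by (intro tendsto_intros summable_LIMSEQ c)
  then have "T \<longlonglongrightarrow> 0" by simp
  then have "(\<lambda>n. (bergman_norm \<alpha> (R n))\<^sup>2) \<longlonglongrightarrow> 0"
    by (rule Lim_null_comparison[OF always_eventually, rotated]) (use bound in simp)
  then have "(\<lambda>n. sqrt ((bergman_norm \<alpha> (R n))\<^sup>2)) \<longlonglongrightarrow> sqrt 0"
    by (rule tendsto_real_sqrt)
  then show ?thesis
    by (simp add: bergman_norm_nonneg R_def B_def residual_def[abs_def])
qed

end
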